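(* Let $Q$ be a finite, non-connected, faithful, subdirectly irreducible locally strictly simple quandle. Then $Q=Q_1\cup Q_2$ has exactly two orbits $Q_1,Q_2$ under $\mathrm{Dis}(Q)$ and, up to exchanging $Q_1$ and $Q_2$ and up to isomorphism, one of the following holds: (i) $Q_1$ is a connected strictly simple quandle, $Q_2=\{x\}$ and $x$ acts trivially on $Q_1$ (i.e. $x*a=a$ for all $a\in Q_1$). (ii) $Q_1=\mathrm{Aff}(\mathbb{Z}_p,-1)$ for a prime $p$, $Q_2=\{1,-1\}\cong\mathcal{P}_2$, and $$(\pm1)*a=a\pm1,\qquad a*(\pm1)=\mp1$$ for every $a\in Q_1$. (iii) $Q_1$ and $Q_2$ are connected strictly simple quandles of the same size.
   Context: A quandle is a set $Q$ with a binary operation $*$ such that every $L_a:b\mapsto a*b$ is a bijection, $a*(b*c)=(a*b)*(a*c)$ and $a*a=a$. $\mathrm{Dis}(Q)=\langle L_aL_b^{-1}: a,b\in Q\rangle$; $Q$ is connected if $\mathrm{Dis}(Q)$ is transitive on $Q$; faithful if $a\mapsto L_a$ is injective. The orbits of $\mathrm{Dis}(Q)$ are subquandles, called the components of $Q$. Congruences are equivalence relations compatible with $*$ and left division; $0_Q$ is equality; $Q$ is subdirectly irreducible if the intersection of all congruences $\neq 0_Q$ is $\ne 0_Q$. A subquandle is proper if it has more than one element and is not all of $Q$; a quandle with more than one element is strictly simple if it has no proper subquandles, and locally strictly simple (LSS) if all its proper subquandles are strictly simple. $\mathcal{P}_2$ is the two-element projection quandle ($a*b=b$). $\mathrm{Aff}(\mathbb{Z}_p,-1)$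 is $\mathbb{Z}_p$ with $a*b=2a-b$. *)

theory Defs
  imports "HOL-Algebra.Group_Action" "HOL-Algebra.Generated_Groups"
    "HOL-Computational_Algebra.Primes"
begin

locale quandle =
  fixes Q :: "'a set" and mul :: "'a \<Rightarrow> 'a \<Rightarrow> 'a" (infixl "\<star>" 70)
  assumes left_bij: "a \<in> Q \<Longrightarrow> bij_betw ((\<star>) a) Q Q"
    and left_distrib: "\<lbrakk>a \<in> Q; b \<in> Q; c \<in> Q\<rbrakk> \<Longrightarrow> a \<star> (b \<star> c) = (a \<star> b) \<star> (a \<star> c)"
    and idem: "a \<in> Q \<Longrightarrow> a \<star> a = a"

text \<open>Left translations are restricted to the carrier: as in \<^const>\<open>BijGroup\<close>, permutations of
  \<open>Q\<close> are extensional functions, so that equality means equality on \<open>Q\<close>.\<close>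

definition left_trans :: "'a set \<Rightarrow> ('a \<Rightarrow> 'a \<Rightarrow> 'a) \<Rightarrow> 'a \<Rightarrow> 'a \<Rightarrow> 'a" where
  "left_trans Q mul a = restrict (mul a) Q"

definition left_div :: "'a set \<Rightarrow> ('a \<Rightarrow> 'a \<Rightarrow> 'a) \<Rightarrow> 'a \<Rightarrow> 'a \<Rightarrow> 'a" where
  "left_div Q mul a = inv_into Q (mul a)"

definition Dis :: "'a set \<Rightarrow> ('a \<Rightarrow> 'a \<Rightarrow> 'a) \<Rightarrow> ('a \<Rightarrow> 'a) monoid" where
  "Dis Q mul = (BijGroup Q) \<lparr>carrier :=
     generate (BijGroup Q)
       {left_trans Q mul a \<otimes>\<^bsub>BijGroup Q\<^esub> inv\<^bsub>BijGroup Q\<^esub> (left_trans Q mul b) | a b.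
         a \<in> Q \<and> b \<in> Q}\<rparr>"

text \<open>The elements of \<^const>\<open>Dis\<close> are themselves permutations of \<open>Q\<close>, hence the action is
  the identity.\<close>

definition components :: "'a set \<Rightarrow> ('a \<Rightarrow> 'a \<Rightarrow> 'a) \<Rightarrow> 'a set set" where
  "components Q mul = orbits (Dis Q mul) Q (\<lambda>g. g)"

definition connected_quandle :: "'a set \<Rightarrow> ('a \<Rightarrow> 'a \<Rightarrow> 'a) \<Rightarrow> bool" where
  "connected_quandle Q mul \<longleftrightarrow>
     quandle Q mul \<and> (\<forall>x\<in>Q. \<forall>y\<in>Q. \<exists>g\<in>carrier (Dis Q mul). g x = y)"

definition faithful_quandle :: "'a set \<Rightarrow> ('a \<Rightarrow> 'a \<Rightarrow> 'a) \<Rightarrow> bool" where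
  "faithful_quandle Q mul \<longleftrightarrow> quandle Q mul \<and> inj_on (left_trans Q mul) Q"

definition quandle_congruence :: "'a set \<Rightarrow> ('a \<Rightarrow> 'a \<Rightarrow> 'a) \<Rightarrow> ('a \<times> 'a) set \<Rightarrow> bool" where
  "quandle_congruence Q mul r \<longleftrightarrow> equiv Q r \<and>
     (\<forall>(a, b)\<in>r. \<forall>(c, d)\<in>r.
        (mul a c, mul b d) \<in> r \<and> (left_div Q mul a c, left_div Q mul b d) \<in> r)"

text \<open>Congruences are subsets of \<open>Q \<times> Q\<close>; the outer intersection with \<open>Q \<times> Q\<close> matters only
  if the family of congruences is empty (\<open>Q\<close> has at most one element).\<close>

definition subdirectly_irreducible :: "'a set \<Rightarrow> ('a \<Rightarrow> 'a \<Rightarrow> 'a) \<Rightarrow> bool" where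
  "subdirectly_irreducible Q mul \<longleftrightarrow> quandle Q mul \<and>
     (Q \<times> Q) \<inter> \<Inter> {r. quandle_congruence Q mul r \<and> r \<noteq> Id_on Q} \<noteq> Id_on Q"

definition nontrivial_set :: "'a set \<Rightarrow> bool" where
  "nontrivial_set S \<longleftrightarrow> (\<exists>x\<in>S. \<exists>y\<in>S. x \<noteq> y)"

definition subquandle :: "'a set \<Rightarrow> 'a set \<Rightarrow> ('a \<Rightarrow> 'a \<Rightarrow> 'a) \<Rightarrow> bool" where
  "subquandle S Q mul \<longleftrightarrow> S \<subseteq> Q \<and> quandle S mul"

definition proper_subquandle :: "'a set \<Rightarrow> 'a set \<Rightarrow> ('a \<Rightarrow> 'a \<Rightarrow> 'a) \<Rightarrow> bool" where
  "proper_subquandle S Q mul \<longleftrightarrow> subquandle S Q mul \<and> nontrivial_set S \<and> S \<noteq> Q"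

definition strictly_simple :: "'a set \<Rightarrow> ('a \<Rightarrow> 'a \<Rightarrow> 'a) \<Rightarrow> bool" where
  "strictly_simple Q mul \<longleftrightarrow>
     quandle Q mul \<and> nontrivial_set Q \<and> \<not> (\<exists>S. proper_subquandle S Q mul)"

definition locally_strictly_simple :: "'a set \<Rightarrow> ('a \<Rightarrow> 'a \<Rightarrow> 'a) \<Rightarrow> bool" where
  "locally_strictly_simple Q mul \<longleftrightarrow>
     quandle Q mul \<and> nontrivial_set Q \<and>
     (\<forall>S. proper_subquandle S Q mul \<longrightarrow> strictly_simple S mul)"

definition quandle_iso ::
  "('a \<Rightarrow> 'b) \<Rightarrow> 'a set \<Rightarrow> ('a \<Rightarrow> 'a \<Rightarrow> 'a) \<Rightarrow> 'b set \<Rightarrow> ('b \<Rightarrow> 'b \<Rightarrow> 'b) \<Rightarrow> bool" where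
  "quandle_iso h Q mul R mul' \<longleftrightarrow>
     bij_betw h Q R \<and> (\<forall>a\<in>Q. \<forall>b\<in>Q. h (mul a b) = mul' (h a) (h b))"

text \<open>The ring \<open>\<int>/p\<close> is represented by the residues \<open>{0..<int p}\<close>.\<close>

definition aff_minus_one :: "nat \<Rightarrow> int \<Rightarrow> int \<Rightarrow> int" where
  "aff_minus_one p a b = (2 * a - b) mod int p"

definition projection :: "'a \<Rightarrow> 'a \<Rightarrow> 'a" where
  "projection a b = b"

end

theory Submission
  imports Defs
begin

text \<open>Write \<open>L\<^sub>x\<close> for the left translation by \<open>x\<close>. A left ideal is a set of elements that all left
  translations map into itself. In a finite quandle the components are the minimal left ideals
  (\<open>component_iff_minimal_left_ideal\<close>), so the group \<^const>\<open>Dis\<close> can be forgotten at once: to prove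
  something for a whole orbit, it is enough that it holds for one element and is inherited by
  its translates (\<open>homogeneous\<close>).

  The union of two orbits is a left ideal, hence a subquandle. If it were proper it would be
  strictly simple, although it contains an orbit with more than one element; so there are only two orbits
  \<open>A\<close> and \<open>B\<close> (\<open>lss_two_components\<close>), each of them a point or strictly simple. A strictly simple finite
  quandle is connected or the two-element projection quandle.

  Faithfulness is used mostly through one fact (\<open>fix_sym\<close>): if \<open>x \<star> y = y\<close>, then \<open>L\<^sub>x\<close> commutes with
  \<open>L\<^sub>y\<close>, because \<open>L\<^bsub>x \<star> y\<^esub>\<close> is the conjugate of \<open>L\<^sub>y\<close> by \<open>L\<^sub>x\<close>; commutation read the other way
  round gives \<open>y \<star> x = x\<close>. If \<open>B = {x}\<close>, then every element of \<open>A\<close> fixes \<open>x\<close>, so \<open>x\<close> acts trivially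
  on \<open>A\<close>.

  If \<open>B = {u, v}\<close> is a projection quandle, every \<open>a \<in> A\<close> swaps \<open>u\<close> and \<open>v\<close>. Then \<open>L\<^sub>a\<close> conjugates
  \<open>L\<^sub>u\<close> to \<open>L\<^sub>v\<close> and fixes \<open>u \<star> (v \<star> a)\<close>; as \<open>A\<close> is strictly simple this forces \<open>u \<star> (v \<star> a) = a\<close>.
  Thus \<open>L\<^sub>v\<close> inverts \<open>L\<^sub>u\<close> on \<open>A\<close>, and the points \<open>L\<^sub>u\<^sup>k a\<close> multiply by \<open>(i, j) \<mapsto> 2 i - j\<close>. They
  form a subquandle, hence all of \<open>A\<close>, and the least period is prime since a proper divisor
  would give a proper subquandle.

  Let both orbits be connected. If two elements of \<open>A\<close> acted alike on \<open>B\<close>, then all would,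
  and then the two orbits would act trivially on each other; collapsing \<open>A\<close> and collapsing \<open>B\<close>
  would be two congruences with trivial intersection, against subdirect irreducibility
  (\<open>acts_faithfully\<close>). If some \<open>a \<star> c = c\<close> with \<open>a \<in> A\<close>, \<open>c \<in> B\<close>, then every element of one orbit
  fixes exactly one point of the other, which matches the two orbits. Otherwise a
  non-identity automorphism of \<open>Q\<close> fixes at most one point, while \<open>L\<^sub>x\<close> is a non-identity
  automorphism fixing \<open>x\<close>. By Burnside's lemma such a group is transitive
  (\<open>transitive_if_fixes_at_most_one\<close>), so some automorphism carries \<open>A\<close> to \<open>B\<close>.\<close>

section \<open>Left ideals\<close>

definition left_ideal :: "'a set \<Rightarrow> ('a \<Rightarrow> 'a \<Rightarrow> 'a) \<Rightarrow> 'a set \<Rightarrow> bool" where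
  "left_ideal Q mul I \<longleftrightarrow> I \<subseteq> Q \<and> (\<forall>a\<in>Q. \<forall>x\<in>I. mul a x \<in> I)"

lemma left_idealI:
  assumes "I \<subseteq> Q" "\<And>a x. \<lbrakk>a \<in> Q; x \<in> I\<rbrakk> \<Longrightarrow> mul a x \<in> I"
  shows "left_ideal Q mul I"
  using assms by (auto simp: left_ideal_def)

lemma left_idealD:
  assumes "left_ideal Q mul I" "a \<in> Q" "x \<in> I"
  shows "mul a x \<in> I"
  using assms by (auto simp: left_ideal_def)

lemma left_ideal_subset: "left_ideal Q mul I \<Longrightarrow> I \<subseteq> Q"
  by (simp add: left_ideal_def)

lemma left_ideal_Un: "left_ideal Q mul I \<Longrightarrow> left_ideal Q mul J \<Longrightarrow> left_ideal Q mul (I \<union> J)"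
  by (auto simp: left_ideal_def)

lemma left_ideal_Int: "left_ideal Q mul I \<Longrightarrow> left_ideal Q mul J \<Longrightarrow> left_ideal Q mul (I \<inter> J)"
  by (auto simp: left_ideal_def)

context quandle
begin

lemma closed: "a \<in> Q \<Longrightarrow> x \<in> Q \<Longrightarrow> a \<star> x \<in> Q"
  by (rule bij_betw_apply[OF left_bij])

lemma cancel: "\<lbrakk>a \<in> Q; x \<in> Q; y \<in> Q\<rbrakk> \<Longrightarrow> a \<star> x = a \<star> y \<longleftrightarrow> x = y"
  using left_bij unfolding bij_betw_def inj_on_def by blast

lemma solve: 
  assumes "a \<in> Q" "y \<in> Q" obtains x where "x \<in> Q" "a \<star> x = y"
proof -
  have "y \<in> (\<star>) a ` Q"
    using bij_betw_imp_surj_on[OF left_bij[OF assms(1)]] assms(2) by simp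
  then show ?thesis using that by auto
qed

lemma left_trans_Bij: "a \<in> Q \<Longrightarrow> left_trans Q (\<star>) a \<in> Bij Q"
  unfolding Bij_def left_trans_def using left_bij bij_betw_restrict_eq by auto

end

locale finite_quandle = quandle +
  assumes finite_carrier: "finite Q"
begin

text \<open>By finiteness an injective self-map is onto, so closure under \<open>\<star>\<close> alone makes a subquandle
  and left division needs no separate check.\<close>

lemma closed_quandle:
  assumes "S \<subseteq> Q" "\<And>a b. \<lbrakk>a \<in> S; b \<in> S\<rbrakk> \<Longrightarrow> a \<star> b \<in> S"
  shows "quandle S (\<star>)"
proof
  fix a assume a: "a \<in> S"
  have "inj_on ((\<star>) a) S"
    using left_bij[of a] a assms(1) by (meson bij_betw_imp_inj_on in_mono inj_on_subset)
  moreover have "(\<star>) a ` S \<subseteq> S"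
    using assms(2) a by blast
  ultimately show "bij_betw ((\<star>) a) S S"
    using endo_inj_surj[OF finite_subset[OF assms(1) finite_carrier]]
    by (simp add: bij_betw_def)
qed (use assms(1) left_distrib idem in \<open>auto simp: subset_iff\<close>)

lemma left_ideal_image:
  assumes "left_ideal Q (\<star>) I" "a \<in> Q"
  shows "(\<star>) a ` I = I"
proof -
  have I: "I \<subseteq> Q" using assms(1) by (rule left_ideal_subset)
  have "inj_on ((\<star>) a) I"
    using left_bij[OF assms(2)] I by (meson bij_betw_imp_inj_on inj_on_subset)
  moreover have "(\<star>) a ` I \<subseteq> I"
    using assms left_idealD by fast
  ultimately show ?thesis
    using endo_inj_surj[OF finite_subset[OF I finite_carrier]] by simp
qed

lemma left_ideal_solve:
  assumes "left_ideal Q (\<star>) I" "a \<in> Q" "y \<in> I"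
  obtains x where "x \<in> I" "a \<star> x = y"
proof -
  have "y \<in> (\<star>) a ` I" using left_ideal_image[OF assms(1,2)] assms(3) by simp
  then show ?thesis using that by auto
qed

lemma left_ideal_quandle: "left_ideal Q (\<star>) I \<Longrightarrow> quandle I (\<star>)"
  by (rule closed_quandle) (auto simp: left_ideal_def)

lemma left_ideal_Diff:
  assumes I: "left_ideal Q (\<star>) I" and J: "left_ideal Q (\<star>) J"
  shows "left_ideal Q (\<star>) (I - J)"
proof (rule left_idealI)
  show "I - J \<subseteq> Q" using left_ideal_subset[OF I] by blast
next
  fix a x assume a: "a \<in> Q" and x: "x \<in> I - J"
  have "a \<star> x \<notin> J"
  proof
    assume "a \<star> x \<in> J"
    then obtain y where "y \<in> J" "a \<star> y = a \<star> x" by (rule left_ideal_solve[OF J a])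
    then show False
      using cancel[OF a] x left_ideal_subset[OF I] left_ideal_subset[OF J] by blast
  qed
  then show "a \<star> x \<in> I - J" using left_idealD[OF I a] x by blast
qed

lemma left_ideal_carrier: "left_ideal Q (\<star>) Q"
  by (auto intro: left_idealI closed)

end

section \<open>Orbits as minimal left ideals\<close>

lemma mem_orbit_iff: "y \<in> orbit G \<phi> x \<longleftrightarrow> (\<exists>g\<in>carrier G. \<phi> g x = y)"
  unfolding orbit_def by blast

lemma subgroup_BijGroup_action:
  assumes "subgroup H (BijGroup E)"
  shows "group_action (BijGroup E \<lparr>carrier := H\<rparr>) E (\<lambda>g. g)"
proof -
  interpret B: group "BijGroup E" by (rule group_BijGroup)
  have "group (BijGroup E \<lparr>carrier := H\<rparr>)"
    using assms by (rule B.subgroup_imp_group)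
  moreover have "(\<lambda>g. g) \<in> hom (BijGroup E \<lparr>carrier := H\<rparr>) (BijGroup E)"
    using subgroup.subset[OF assms] by (auto simp: hom_def)
  ultimately show ?thesis
    unfolding group_action_def group_hom_def group_hom_axioms_def by (simp add: group_BijGroup)
qed

lemma subgroup_setwise_stabilizer:
  assumes "I \<subseteq> E"
  shows "subgroup {g \<in> Bij E. g ` I = I} (BijGroup E)"
proof -
  interpret B: group "BijGroup E" by (rule group_BijGroup)
  show ?thesis
  proof (rule B.subgroupI)
    show "{g \<in> Bij E. g ` I = I} \<subseteq> carrier (BijGroup E)" by (auto simp: BijGroup_def)
    show "{g \<in> Bij E. g ` I = I} \<noteq> {}" using id_Bij[of E] assms by force
  next
    fix g assume g: "g \<in> {g \<in> Bij E. g ` I = I}"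
    have "inv_into E g ` I = I"
      using g assms inv_into_image_cancel[of g E I] by (simp add: Bij_def bij_betw_def)
    moreover have "restrict (inv_into E g) E ` I = inv_into E g ` I" using assms by (auto simp: image_iff)
    ultimately show "inv\<^bsub>BijGroup E\<^esub> g \<in> {g \<in> Bij E. g ` I = I}"
      using g by (simp add: inv_BijGroup restrict_inv_into_Bij del: restrict_apply)
  next
    fix g h assume g: "g \<in> {g \<in> Bij E. g ` I = I}" and h: "h \<in> {g \<in> Bij E. g ` I = I}"
    have "compose E g h ` I = (g \<circ> h) ` I"
      using assms by (intro image_cong refl) (auto simp: compose_def)
    also have "\<dots> = I" using g h by (simp only: image_comp[symmetric]) simp
    finally have "compose E g h ` I = I" .
    then show "g \<otimes>\<^bsub>BijGroup E\<^esub> h \<in> {g \<in> Bij E. g ` I = I}"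
      using g h by (auto simp: BijGroup_def compose_Bij)
  qed
qed

context finite_quandle
begin

abbreviation Dis_gens where
  "Dis_gens \<equiv> {left_trans Q (\<star>) a \<otimes>\<^bsub>BijGroup Q\<^esub> inv\<^bsub>BijGroup Q\<^esub> (left_trans Q (\<star>) b) | a b. a \<in> Q \<and> b \<in> Q}"

lemma Dis_gens_subset:
  assumes H: "subgroup H (BijGroup Q)" and L: "\<And>a. a \<in> Q \<Longrightarrow> left_trans Q (\<star>) a \<in> H"
  shows "Dis_gens \<subseteq> H"
  using L subgroup.m_closed[OF H] subgroup.m_inv_closed[OF H] by auto

lemma Dis_subgroup: "subgroup (carrier (Dis Q (\<star>))) (BijGroup Q)"
proof -
  interpret B: group "BijGroup Q" by (rule group_BijGroup)
  have "Dis_gens \<subseteq> carrier (BijGroup Q)"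
    by (rule Dis_gens_subset[OF B.subgroup_self]) (simp add: BijGroup_def left_trans_Bij)
  then show ?thesis by (simp add: Dis_def B.generate_is_subgroup)
qed

lemma Dis_action: "group_action (Dis Q (\<star>)) Q (\<lambda>g. g)"
  using subgroup_BijGroup_action[OF Dis_subgroup] by (simp add: Dis_def)

text \<open>The permutations that map \<open>I\<close> onto itself form a subgroup that contains all left
  translations, hence the generators of \<^const>\<open>Dis\<close>.\<close>

lemma Dis_preserves_left_ideal:
  assumes "left_ideal Q (\<star>) I" "g \<in> carrier (Dis Q (\<star>))" "x \<in> I"
  shows "g x \<in> I"
proof -
  interpret B: group "BijGroup Q" by (rule group_BijGroup)
  let ?H = "{g \<in> Bij Q. g ` I = I}"
  have I: "I \<subseteq> Q" using assms(1) by (rule left_ideal_subset)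
  have sub: "subgroup ?H (BijGroup Q)" using I by (rule subgroup_setwise_stabilizer)
  have "left_trans Q (\<star>) a \<in> ?H" if "a \<in> Q" for a
  proof -
    have "left_trans Q (\<star>) a ` I = (\<star>) a ` I" using I by (auto simp: left_trans_def image_iff)
    then show ?thesis using left_ideal_image[OF assms(1) that] left_trans_Bij[OF that] by simp
  qed
  then have "generate (BijGroup Q) Dis_gens \<subseteq> ?H"
    by (intro B.generate_subgroup_incl[OF Dis_gens_subset sub] sub)
  then show ?thesis using assms(2,3) by (auto simp: Dis_def)
qed

text \<open>The orbits of \<^const>\<open>Dis\<close> are closed under single translations because \<open>y\<close> is fixed by its own
  translation: \<open>a \<star> y\<close> is the image of \<open>y\<close> under the displacement \<open>L\<^sub>a L\<^sub>y\<^sup>-\<^sup>1\<close>.\<close>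

lemma left_ideal_orbit:
  assumes "x \<in> Q"
  shows "left_ideal Q (\<star>) (orbit (Dis Q (\<star>)) (\<lambda>g. g) x)"
proof (rule left_idealI)
  interpret D: group_action "Dis Q (\<star>)" Q "\<lambda>g. g" by (rule Dis_action)
  interpret B: group "BijGroup Q" by (rule group_BijGroup)
  show sub: "orbit (Dis Q (\<star>)) (\<lambda>g. g) x \<subseteq> Q"
    using D.element_image[OF _ assms] by (auto simp: orbit_def)
  fix a y assume a: "a \<in> Q" and y: "y \<in> orbit (Dis Q (\<star>)) (\<lambda>g. g) x"
  have yQ: "y \<in> Q" using sub y by blast
  let ?L = "left_trans Q (\<star>)"
  let ?d = "?L a \<otimes>\<^bsub>BijGroup Q\<^esub> inv\<^bsub>BijGroup Q\<^esub> (?L y)"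
  have d: "?d \<in> carrier (Dis Q (\<star>))"
    unfolding Dis_def using a yQ by (auto intro!: generate.incl)
  have L: "?L a \<in> Bij Q" "?L y \<in> Bij Q" using left_trans_Bij a yQ by auto
  have "inv_into Q (?L y) y = y"
    using L(2) yQ idem[OF yQ] unfolding Bij_def bij_betw_def
    by (metis (no_types, lifting) IntD2 inv_into_f_f left_trans_def mem_Collect_eq restrict_apply')
  then have "?d y = a \<star> y"
    using L yQ restrict_inv_into_Bij[OF L(2)]
    by (simp add: inv_BijGroup) (simp add: BijGroup_def compose_def left_trans_def)
  then have "\<exists>g\<in>carrier (Dis Q (\<star>)). g y = a \<star> y" using d by (rule bexI)
  then have "a \<star> y \<in> orbit (Dis Q (\<star>)) (\<lambda>g. g) y" by (simp add: mem_orbit_iff)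
  then show "a \<star> y \<in> orbit (Dis Q (\<star>)) (\<lambda>g. g) x"
    using D.orbit_trans[OF assms yQ closed[OF a yQ]] y by blast
qed

lemma component_iff_minimal_left_ideal:
  "C \<in> components Q (\<star>) \<longleftrightarrow> left_ideal Q (\<star>) C \<and> C \<noteq> {} \<and>
     (\<forall>I. left_ideal Q (\<star>) I \<and> I \<subseteq> C \<and> I \<noteq> {} \<longrightarrow> I = C)"
proof -
  interpret D: group_action "Dis Q (\<star>)" Q "\<lambda>g. g" by (rule Dis_action)
  let ?o = "orbit (Dis Q (\<star>)) (\<lambda>g. g)"
  have below: "?o x \<subseteq> I" if "left_ideal Q (\<star>) I" "x \<in> I" for I x
    using Dis_preserves_left_ideal[OF that(1) _ that(2)] by (auto simp: orbit_def)
  show ?thesis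
  proof
    assume "C \<in> components Q (\<star>)"
    then obtain x where x: "x \<in> Q" "C = ?o x" by (auto simp: components_def orbits_def)
    have "I = C" if I: "left_ideal Q (\<star>) I" "I \<subseteq> C" "y \<in> I" for I y
    proof -
      have "y \<in> Q" using left_ideal_subset[OF I(1)] I(3) by blast
      then have "x \<in> ?o y" using D.orbit_sym[OF x(1)] I x(2) by blast
      then have "x \<in> I" using below[OF I(1,3)] by blast
      then show ?thesis using below[OF I(1)] I(2) x(2) by blast
    qed
    then show "left_ideal Q (\<star>) C \<and> C \<noteq> {} \<and>
        (\<forall>I. left_ideal Q (\<star>) I \<and> I \<subseteq> C \<and> I \<noteq> {} \<longrightarrow> I = C)"
      using left_ideal_orbit D.orbit_refl x by blast
  next
    assume C: "left_ideal Q (\<star>) C \<and> C \<noteq> {} \<and>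
        (\<forall>I. left_ideal Q (\<star>) I \<and> I \<subseteq> C \<and> I \<noteq> {} \<longrightarrow> I = C)"
    then obtain x where x: "x \<in> C" by blast
    have "C \<subseteq> Q" using C left_ideal_subset by auto
    then have xQ: "x \<in> Q" using x by (rule subsetD)
    have "?o x \<subseteq> C" using C x by (intro below) auto
    moreover have "?o x \<noteq> {}" using D.orbit_refl[OF xQ] by blast
    ultimately have "?o x = C" using C left_ideal_orbit[OF xQ] by simp
    then show "C \<in> components Q (\<star>)" using xQ by (auto simp: components_def orbits_def)
  qed
qed

lemma component_subset_left_ideal:
  assumes "C \<in> components Q (\<star>)" "left_ideal Q (\<star>) I" "x \<in> C" "x \<in> I" 
  shows "C \<subseteq> I"
proof -
  have "left_ideal Q (\<star>) (I \<inter> C)"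
    using assms left_ideal_Int component_iff_minimal_left_ideal by blast
  then show ?thesis using assms component_iff_minimal_left_ideal by blast
qed

lemma connected_iff: "connected_quandle Q (\<star>) \<longleftrightarrow>
    (\<forall>I. left_ideal Q (\<star>) I \<and> I \<noteq> {} \<longrightarrow> I = Q)"
proof -
  interpret D: group_action "Dis Q (\<star>)" Q "\<lambda>g. g" by (rule Dis_action)
  let ?o = "orbit (Dis Q (\<star>)) (\<lambda>g. g)"
  have "connected_quandle Q (\<star>) \<longleftrightarrow> (\<forall>x\<in>Q. Q \<subseteq> ?o x)"
    using quandle_axioms by (fastforce simp: connected_quandle_def orbit_def)
  also have "\<dots> \<longleftrightarrow> (\<forall>I. left_ideal Q (\<star>) I \<and> I \<noteq> {} \<longrightarrow> I = Q)"
  proof safe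
    fix I x y assume *: "\<forall>x\<in>Q. Q \<subseteq> ?o x" "left_ideal Q (\<star>) I" "x \<in> I" "y \<in> Q"
    have "x \<in> Q" using left_ideal_subset[OF *(2)] *(3) by blast
    then have "y \<in> ?o x" using * by blast
    then show "y \<in> I" using Dis_preserves_left_ideal[OF *(2) _ *(3)] by (auto simp: orbit_def)
  next
    fix I x y assume *: "left_ideal Q (\<star>) I" "y \<in> I"
    then show "y \<in> Q" using left_ideal_subset by blast
  next
    fix x y assume *: "\<forall>I. left_ideal Q (\<star>) I \<and> I \<noteq> {} \<longrightarrow> I = Q" "x \<in> Q" "y \<in> Q"
    then show "y \<in> ?o x" using left_ideal_orbit D.orbit_refl by blast
  qed
  finally show ?thesis .
qed

end

section \<open>Strictly simple subquandles and the number of orbits\<close>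

context finite_quandle
begin

lemma subset_finite_quandle:
  assumes "S \<subseteq> Q" "quandle S (\<star>)"
  shows "finite_quandle S (\<star>)"
  using assms finite_subset[OF assms(1) finite_carrier]
  by (simp add: finite_quandle_def finite_quandle_axioms_def)

lemma strictly_simple_full:
  assumes "strictly_simple S (\<star>)" "S \<subseteq> Q" "T \<subseteq> S"
    and "\<And>a b. \<lbrakk>a \<in> T; b \<in> T\<rbrakk> \<Longrightarrow> a \<star> b \<in> T"
    and "x \<in> T" "y \<in> T" "x \<noteq> y"
  shows "T = S"
proof (rule ccontr)
  assume "T \<noteq> S"
  moreover have "quandle T (\<star>)" using assms(2,3,4) by (intro closed_quandle) auto
  moreover have "nontrivial_set T" using assms(5-7) by (auto simp: nontrivial_set_def)
  ultimately have "proper_subquandle T S (\<star>)"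
    using assms(3) by (simp add: proper_subquandle_def subquandle_def)
  then show False using assms(1) by (auto simp: strictly_simple_def)
qed

text \<open>A proper left ideal and its complement are both subquandles, so both are single points;
  being left ideals, they are fixed by everything.\<close>

lemma strictly_simple_disconnected:
  assumes S: "strictly_simple S (\<star>)" "S \<subseteq> Q" and nc: "\<not> connected_quandle S (\<star>)"
  obtains u v where "u \<noteq> v" "S = {u, v}" "\<And>a b. \<lbrakk>a \<in> S; b \<in> S\<rbrakk> \<Longrightarrow> a \<star> b = b"
proof -
  interpret S: finite_quandle S "(\<star>)"
    using subset_finite_quandle S by (simp add: strictly_simple_def)
  obtain I where I: "left_ideal S (\<star>) I" "I \<noteq> {}" "I \<noteq> S" 
    using nc S.connected_iff by auto
  have single: "\<exists>x. J = {x}" if J: "left_ideal S (\<star>) J" "J \<noteq> {}" "J \<noteq> S" for J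
  proof -
    have JS: "J \<subseteq> S" using J(1) by (rule left_ideal_subset)
    obtain x where x: "x \<in> J" using J(2) by auto
    have cl: "a \<star> b \<in> J" if "a \<in> J" "b \<in> J" for a b 
      using left_idealD[OF J(1)] JS that by auto
    have "y = x" if y: "y \<in> J" for y
    proof (rule ccontr)
      assume "y \<noteq> x"
      with J(3) show False using strictly_simple_full[OF S JS cl y x] by simp
    qed
    then have "J = {x}" using x by blast
    then show ?thesis by (rule exI)
  qed
  have J: "left_ideal S (\<star>) (S - I)" by (rule S.left_ideal_Diff[OF S.left_ideal_carrier I(1)])
  have IS: "I \<subseteq> S" using I(1) by (rule left_ideal_subset)
  obtain u where u: "I = {u}" using single[OF I] by auto
  obtain v where v: "S - I = {v}" using single[OF J] I IS by auto
  have "S = {u, v}" "u \<noteq> v" using u v IS by auto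
  moreover have "a \<star> b = b" if "a \<in> S" "b \<in> S" for a b
  proof -
    have "a \<star> u = u" using left_idealD[OF I(1) that(1), of u] u by simp
    moreover have "a \<star> v = v" using left_idealD[OF J that(1), of v] v by simp
    ultimately show ?thesis using that(2) \<open>S = {u, v}\<close> by auto
  qed
  ultimately show ?thesis using that[of u v] by simp
qed

text \<open>Some orbit has more than one element, for otherwise all translations are the identity, against
  faithfulness. Its union with any other orbit is a subquandle that is not strictly simple,
  and therefore is everything.\<close>

lemma lss_two_components:
  assumes nc: "\<not> connected_quandle Q (\<star>)" and f: "faithful_quandle Q (\<star>)"
    and lss: "locally_strictly_simple Q (\<star>)"
  obtains C D where "components Q (\<star>) = {C, D}" "C \<noteq> D" "C \<union> D = Q" "C \<inter> D = {}"
    "strictly_simple C (\<star>)" "strictly_simple D (\<star>) \<or> (\<exists>x. D = {x})"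
proof -
  interpret D: group_action "Dis Q (\<star>)" Q "\<lambda>g. g" by (rule Dis_action)
  have cover: "\<Union> (components Q (\<star>)) = Q"
    using D.orbits_coverture by (simp add: components_def)
  have disj: "C = D \<or> C \<inter> D = {}" if "C \<in> components Q (\<star>)" "D \<in> components Q (\<star>)" for C D
    using D.disjoint_union that by (simp add: components_def)
  have li: "left_ideal Q (\<star>) C" "C \<noteq> {}" if "C \<in> components Q (\<star>)" for C
    using that by (auto simp: component_iff_minimal_left_ideal)
  have proper: "strictly_simple S (\<star>)" if "left_ideal Q (\<star>) S" "S \<noteq> Q" "x \<in> S" "y \<in> S" "x \<noteq> y" for S x y
  proof -
    have "proper_subquandle S Q (\<star>)"
      using that left_ideal_quandle[OF that(1)] left_ideal_subset[OF that(1)]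
      by (auto simp: proper_subquandle_def subquandle_def nontrivial_set_def)
    then show ?thesis using lss by (simp add: locally_strictly_simple_def)
  qed
  have one: "C \<noteq> Q" if C: "C \<in> components Q (\<star>)" for C
  proof
    assume "C = Q"
    then have "\<forall>I. left_ideal Q (\<star>) I \<and> I \<noteq> {} \<longrightarrow> I = Q"
      using C left_ideal_subset[of Q "(\<star>)"] unfolding component_iff_minimal_left_ideal by auto
    then show False using nc by (simp add: connected_iff)
  qed
  have "\<exists>C\<in>components Q (\<star>). \<not> (\<exists>x. C = {x})"
  proof (rule ccontr)
    assume "\<not> ?thesis"
    then have sing: "\<And>C. C \<in> components Q (\<star>) \<Longrightarrow> \<exists>x. C = {x}" by simp
    have proj: "a \<star> x = x" if a: "a \<in> Q" and x: "x \<in> Q" for a x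
    proof -
      obtain C where C: "C \<in> components Q (\<star>)" "x \<in> C" using cover x by auto
      moreover obtain z where "C = {z}" using sing[OF C(1)] by auto
      ultimately show ?thesis using left_idealD[OF li(1)[OF C(1)] a, of x] by simp
    qed
    have "left_trans Q (\<star>) a = left_trans Q (\<star>) b" if "a \<in> Q" "b \<in> Q" for a b
      unfolding left_trans_def using proj that by (intro restrict_ext) simp
    then have "a = b" if "a \<in> Q" "b \<in> Q" for a b
      using f that unfolding faithful_quandle_def inj_on_def by blast
    moreover obtain a b where "a \<in> Q" "b \<in> Q" "a \<noteq> b"
      using lss by (auto simp: locally_strictly_simple_def nontrivial_set_def)
    ultimately show False by blast
  qed
  then obtain C where C: "C \<in> components Q (\<star>)" "\<not> (\<exists>x. C = {x})" by auto
  obtain x where x: "x \<in> C" using li(2)[OF C(1)] by auto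
  obtain y where y: "y \<in> C" "y \<noteq> x" using x C(2) by auto
  have "C \<subseteq> Q" using li(1)[OF C(1)] by (rule left_ideal_subset)
  then obtain z where z: "z \<in> Q" "z \<notin> C" using one[OF C(1)] by auto
  then obtain D where D: "D \<in> components Q (\<star>)" "z \<in> D" using cover by auto
  have CD: "C \<noteq> D" using z(2) D(2) by auto
  have dis: "C \<inter> D = {}" using disj[OF C(1) D(1)] CD by simp
  have un: "left_ideal Q (\<star>) (C \<union> D)" using li(1) C(1) D(1) by (intro left_ideal_Un) auto
  have all: "C \<union> D = Q"
  proof (rule ccontr)
    assume "C \<union> D \<noteq> Q"
    then have ss: "strictly_simple (C \<union> D) (\<star>)" using proper[OF un _ _ _ y(2)] x y(1) by simp
    have cl: "a \<star> b \<in> C" if "a \<in> C" "b \<in> C" for a b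
      using left_idealD[OF li(1)[OF C(1)] _ that(2)] that(1) \<open>C \<subseteq> Q\<close> by auto
    have "C = C \<union> D"
      using strictly_simple_full[OF ss left_ideal_subset[OF un] _ cl x y(1)] y(2) by auto
    then show False using z(2) D(2) by auto
  qed
  have "components Q (\<star>) \<subseteq> {C, D}"
  proof
    fix E assume E: "E \<in> components Q (\<star>)"
    obtain w where "w \<in> E" using li(2)[OF E] by auto
    then have "w \<in> C \<or> w \<in> D" using left_ideal_subset[OF li(1)[OF E]] all by auto
    then show "E \<in> {C, D}" using disj[OF E C(1)] disj[OF E D(1)] \<open>w \<in> E\<close> by auto
  qed
  then have comps: "components Q (\<star>) = {C, D}" using C(1) D(1) by auto
  have ssC: "strictly_simple C (\<star>)" using proper[OF li(1)[OF C(1)] one[OF C(1)] y(1) x y(2)] .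
  have ssD: "strictly_simple D (\<star>) \<or> (\<exists>x. D = {x})"
  proof (cases "\<exists>w\<in>D. w \<noteq> z")
    case True
    then show ?thesis using proper[OF li(1)[OF D(1)] one[OF D(1)] _ D(2)] by auto
  next
    case False
    then have "D = {z}" using D(2) by blast
    then show ?thesis by auto
  qed
  show ?thesis using that[OF comps CD all dis ssC ssD] .
qed

end

section \<open>Faithful quandles with two orbits\<close>

locale faithful_two_orbits = finite_quandle +
  fixes A B :: "'a set"
  assumes faithful: "\<lbrakk>x \<in> Q; y \<in> Q; \<And>z. z \<in> Q \<Longrightarrow> x \<star> z = y \<star> z\<rbrakk> \<Longrightarrow> x = y"
    and ideal_A: "left_ideal Q (\<star>) A" and ideal_B: "left_ideal Q (\<star>) B"
    and minimal_A: "\<lbrakk>left_ideal Q (\<star>) I; x \<in> A; x \<in> I\<rbrakk> \<Longrightarrow> A \<subseteq> I"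
    and minimal_B: "\<lbrakk>left_ideal Q (\<star>) I; x \<in> B; x \<in> I\<rbrakk> \<Longrightarrow> B \<subseteq> I"
    and cover: "A \<union> B = Q" and disjoint: "A \<inter> B = {}"
begin

lemma swap: "faithful_two_orbits Q (\<star>) B A"
proof 
  show "x = y" if "x \<in> Q" "y \<in> Q" "\<And>z. z \<in> Q \<Longrightarrow> x \<star> z = y \<star> z" for x y
    using that by (rule faithful)
  show "B \<union> A = Q" "B \<inter> A = {}" using cover disjoint by auto
qed (fact ideal_A ideal_B minimal_A minimal_B)+

lemma A_subset: "x \<in> A \<Longrightarrow> x \<in> Q" and B_subset: "x \<in> B \<Longrightarrow> x \<in> Q"
  using cover by auto

lemma A_closed: "q \<in> Q \<Longrightarrow> x \<in> A \<Longrightarrow> q \<star> x \<in> A"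
  by (rule left_idealD[OF ideal_A])

lemma B_closed: "q \<in> Q \<Longrightarrow> x \<in> B \<Longrightarrow> q \<star> x \<in> B"
  by (rule left_idealD[OF ideal_B])

text \<open>The hypothesis and the conclusion both say that \<open>L\<^sub>x\<close> and \<open>L\<^sub>y\<close> commute: \<open>L\<^bsub>x \<star> y\<^esub> = L\<^sub>x L\<^sub>y L\<^sub>x\<^sup>-\<^sup>1\<close>, and
  faithfulness recovers an element from its translation.\<close>

lemma fix_sym:
  assumes "x \<in> Q" "y \<in> Q" "x \<star> y = y"
  shows "y \<star> x = x"
proof (rule faithful)
  show "y \<star> x \<in> Q" "x \<in> Q" using assms closed by auto
  fix w assume "w \<in> Q"
  then obtain z where z: "z \<in> Q" "y \<star> z = w" using solve[OF assms(2)] by metis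
  have "(y \<star> x) \<star> (y \<star> z) = y \<star> (x \<star> z)" using assms z left_distrib by simp
  also have "\<dots> = x \<star> (y \<star> z)" using assms z left_distrib[of x y z] by simp
  finally show "(y \<star> x) \<star> w = x \<star> w" using z by simp
qed

text \<open>This replaces transitivity of the group on the orbit: the elements with an inherited
  property form a left ideal, and \<open>A\<close> is minimal.\<close>

lemma homogeneous:
  assumes "a0 \<in> A" "P a0" "\<And>q a. \<lbrakk>q \<in> Q; a \<in> A; P a\<rbrakk> \<Longrightarrow> P (q \<star> a)" "a \<in> A"
  shows "P a"
proof -
  have "left_ideal Q (\<star>) {a \<in> A. P a}"
    by (rule left_idealI) (use assms(3) A_closed A_subset in auto)
  then have "A \<subseteq> {a \<in> A. P a}" using assms(1,2) by (intro minimal_A[where x = a0]) auto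
  then show ?thesis using assms(4) by auto
qed

lemma trivial_action_spreads:
  assumes T: "left_ideal Q (\<star>) T" and "a \<in> A" "\<And>t. t \<in> T \<Longrightarrow> a \<star> t = t"
    and "c \<in> A" "t \<in> T"
  shows "c \<star> t = t"
proof -
  have "\<forall>t\<in>T. c \<star> t = t"
  proof (rule homogeneous[where P = "\<lambda>c. \<forall>t\<in>T. c \<star> t = t", OF \<open>a \<in> A\<close> _ _ \<open>c \<in> A\<close>])
    show "\<forall>t\<in>T. a \<star> t = t" using assms(3) by blast
    fix q e assume q: "q \<in> Q" "e \<in> A" "\<forall>t\<in>T. e \<star> t = t"
    show "\<forall>t\<in>T. (q \<star> e) \<star> t = t"
    proof
      fix t assume "t \<in> T"
      then obtain w where w: "w \<in> T" "q \<star> w = t" by (rule left_ideal_solve[OF T q(1)])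
      then have "w \<in> Q" using left_ideal_subset[OF T] by blast
      then show "(q \<star> e) \<star> t = t"
        using left_distrib[of q e w] q A_subset w by simp
    qed
  qed
  then show ?thesis using assms(5) by blast
qed

text \<open>If one element acts trivially then all do, and then points are left ideals of \<open>A\<close>.\<close>

lemma connected_not_trivial:
  assumes "connected_quandle A (\<star>)" "strictly_simple A (\<star>)" "a \<in> A"
  shows "\<exists>b\<in>A. a \<star> b \<noteq> b"
proof (rule ccontr)
  assume "\<not> ?thesis"
  then have tr: "\<And>b. b \<in> A \<Longrightarrow> a \<star> b = b" by blast
  have tr': "c \<star> b = b" if "c \<in> A" "b \<in> A" for b c
    using trivial_action_spreads[OF ideal_A assms(3) tr] that by blast
  interpret A: finite_quandle A "(\<star>)"
    using subset_finite_quandle[OF left_ideal_subset[OF ideal_A]] assms(2)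
    by (simp add: strictly_simple_def)
  have "left_ideal A (\<star>) {a}" using tr' assms(3) by (intro left_idealI) simp_all
  then have "{a} = A" using assms(1) by (simp add: A.connected_iff)
  then show False using assms(2) by (auto simp: strictly_simple_def nontrivial_set_def)
qed

lemma singleton_acts_trivially:
  assumes "B = {x}" "a \<in> A"
  shows "x \<star> a = a"
proof (rule fix_sym)
  show "a \<in> Q" "x \<in> Q" using assms cover by auto
  then show "a \<star> x = x" using B_closed[of a x] assms by auto
qed

end

section \<open>An orbit of two elements\<close>

locale pair_orbit = faithful_two_orbits +
  fixes u v
  assumes B_eq: "B = {u, v}" and uv: "u \<noteq> v"
    and B_proj: "\<lbrakk>a \<in> B; b \<in> B\<rbrakk> \<Longrightarrow> a \<star> b = b"
begin

lemma uvQ: "u \<in> Q" "v \<in> Q" using B_eq cover by auto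

text \<open>Some element of \<open>A\<close> moves \<open>u\<close> because \<open>{u}\<close> is not an orbit. Conjugation cannot change this
  since the symmetric group on two points is abelian.\<close>

lemma swaps:
  assumes "a \<in> A"
  shows "a \<star> u = v \<and> a \<star> v = u"
proof -
  have inB: "q \<star> u \<in> {u, v}" "q \<star> v \<in> {u, v}" "q \<star> u \<noteq> q \<star> v" if "q \<in> Q" for q
    using B_closed[OF that, of u] B_closed[OF that, of v] B_eq cancel[OF that uvQ] uv by auto
  obtain q where q: "q \<in> Q" "q \<star> u \<noteq> u"
  proof (rule ccontr)
    assume "\<not> thesis"
    then have "\<And>q. q \<in> Q \<Longrightarrow> q \<star> u = u" using that by auto
    then have "left_ideal Q (\<star>) {u}" using uvQ by (intro left_idealI) auto
    then have "B \<subseteq> {u}" using B_eq by (intro minimal_B[where x = u]) auto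
    then show False using B_eq uv by auto
  qed
  have "q \<in> A" using q B_proj[of q u] B_eq cover by auto
  moreover have "q \<star> u = v" using inB[OF q(1)] q(2) by auto
  moreover have "(r \<star> b) \<star> u = v" if r: "r \<in> Q" "b \<in> A" "b \<star> u = v" for r b
  proof -
    have "(r \<star> b) \<star> (r \<star> u) = r \<star> v"
      using left_distrib[of r b u] r A_subset uvQ by simp
    then show ?thesis using inB[OF r(1)] inB[of "r \<star> b"] closed[OF r(1) A_subset[OF r(2)]] by auto
  qed
  ultimately have "a \<star> u = v" using homogeneous[of q "\<lambda>a. a \<star> u = v" a] assms by auto
  then show ?thesis using inB[of a] A_subset[OF assms] by auto
qed

text \<open>Otherwise \<open>A\<close> acts trivially on itself, and as all its elements swap \<open>u\<close> and \<open>v\<close>,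
  faithfulness leaves only \<open>A = {a}\<close>; but then \<open>u\<close> and \<open>v\<close> both act trivially.\<close>

lemma A_not_trivial:
  assumes "a \<in> A"
  obtains b where "b \<in> A" "a \<star> b \<noteq> b"
proof (rule ccontr)
  assume "\<not> thesis"
  then have tr: "\<And>b. b \<in> A \<Longrightarrow> a \<star> b = b" using that by auto
  have tr': "c \<star> b = b" if "c \<in> A" "b \<in> A" for b c
    using trivial_action_spreads[OF ideal_A assms tr] that by blast
  have "c = a" if c: "c \<in> A" for c
  proof (rule faithful)
    fix z assume "z \<in> Q"
    then consider "z \<in> A" | "z = u" | "z = v" using B_eq cover by auto
    then show "c \<star> z = a \<star> z"
      by cases (simp_all add: tr'[OF c] tr'[OF assms] swaps[OF c] swaps[OF assms])
  qed (use c assms A_subset in auto)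
  then have A: "A = {a}" using assms by blast
  have "u = v"
  proof (rule faithful)
    fix z assume "z \<in> Q"
    then consider "z = a" | "z \<in> B" using A cover by auto
    then show "u \<star> z = v \<star> z"
    proof cases
      case 1
      then show ?thesis using A_closed[of u a] A_closed[of v a] uvQ A by auto
    next
      case 2
      then show ?thesis using B_proj[of u z] B_proj[of v z] B_eq by simp
    qed
  qed (use uvQ in auto)
  then show False using uv by simp
qed

end

context pair_orbit
begin

text \<open>The orbit of \<open>a\<close> under the powers of \<open>L\<^sub>u\<close>. Negative powers use \<open>L\<^sub>v\<close>, which turns out to be
  the inverse of \<open>L\<^sub>u\<close> on \<open>A\<close> (\<open>uv_inverse\<close>).\<close>

definition cycle_at :: "'a \<Rightarrow> int \<Rightarrow> 'a" where
  "cycle_at a k = (if k \<ge> 0 then ((\<star>) u ^^ nat k) a else ((\<star>) v ^^ nat (- k)) a)"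

context
  assumes simple_A: "strictly_simple A (\<star>)"
begin

lemma no_fixed_point: "a \<in> A \<Longrightarrow> u \<star> a \<noteq> a"
  using fix_sym[of u a] swaps[of a] uvQ A_subset uv by auto

lemma uv_commute: 
  assumes "a \<in> A" shows "u \<star> (v \<star> a) = v \<star> (u \<star> a)"
  using left_distrib[of u v a] uvQ A_subset[OF assms] B_proj[of u v] B_eq by simp

text \<open>Since \<open>L\<^sub>a\<close> exchanges \<open>L\<^sub>u\<close> and \<open>L\<^sub>v\<close> under conjugation and these commute, it fixes
  \<open>u \<star> (v \<star> a)\<close> along with \<open>a\<close>. The fixed points of \<open>L\<^sub>a\<close> in \<open>A\<close> form a subquandle; two of them
  would make \<open>L\<^sub>a\<close> trivial on \<open>A\<close>.\<close>

lemma uv_inverse: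
  assumes a: "a \<in> A"
  shows "u \<star> (v \<star> a) = a"
proof (rule ccontr)
  define z where "z = u \<star> (v \<star> a)"
  assume "u \<star> (v \<star> a) \<noteq> a"
  then have za: "z \<noteq> a" by (simp add: z_def)
  have aQ: "a \<in> Q" using a by (rule A_subset)
  have z: "z \<in> A" unfolding z_def using A_closed uvQ a by simp
  have "a \<star> z = (a \<star> u) \<star> ((a \<star> v) \<star> (a \<star> a))"
    unfolding z_def
    using left_distrib[of a u "v \<star> a"] left_distrib[of a v a] aQ uvQ closed[of v a] by simp
  also have "\<dots> = z" using swaps[OF a] idem[OF aQ] uv_commute[OF a] by (simp add: z_def)
  finally have "a \<star> z = z" .
  \<comment> \<open>\<open>a\<close> and \<open>z\<close> are two distinct points of this subquandle.\<close>
  have "{x \<in> A. a \<star> x = x} = A"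
  proof (rule strictly_simple_full[OF simple_A left_ideal_subset[OF ideal_A] _ _ _ _ za])
    fix x y assume "x \<in> {x \<in> A. a \<star> x = x}" "y \<in> {x \<in> A. a \<star> x = x}"
    then show "x \<star> y \<in> {x \<in> A. a \<star> x = x}"
      using left_distrib[of a x y] aQ A_subset A_closed by simp
  qed (use \<open>a \<star> z = z\<close> z a idem[OF aQ] in auto)
  then have "\<And>x. x \<in> A \<Longrightarrow> a \<star> x = x" by blast
  then show False using A_not_trivial[OF a] by metis
qed

lemma funpow_in_A: "a \<in> A \<Longrightarrow> q \<in> Q \<Longrightarrow> ((\<star>) q ^^ n) a \<in> A"
  by (induction n) (simp_all add: A_closed)

lemma cycle_at_in: "a \<in> A \<Longrightarrow> cycle_at a k \<in> A"
  by (simp add: cycle_at_def funpow_in_A uvQ)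

lemma cycle_at_succ:
  assumes "a \<in> A"
  shows "cycle_at a (k + 1) = u \<star> cycle_at a k"
proof (cases "k \<ge> 0")
  case True
  then have "nat (k + 1) = Suc (nat k)" by simp
  then show ?thesis using True by (simp add: cycle_at_def)
next
  case False
  define m where "m = nat (- (k + 1))"
  have "nat (- k) = Suc m" "cycle_at a (k + 1) = ((\<star>) v ^^ m) a"
    using False by (auto simp: m_def cycle_at_def)
  then show ?thesis
    using False uv_inverse[OF funpow_in_A[OF assms uvQ(2)]] by (simp add: cycle_at_def)
qed

lemma cycle_at_pred:
  assumes "a \<in> A"
  shows "cycle_at a (k - 1) = v \<star> cycle_at a k"
  using cycle_at_succ[OF assms, of "k - 1"] cycle_at_in[OF assms, of "k - 1"]
    uv_commute uv_inverse by simp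

text \<open>Induction on \<open>j\<close> in both directions from \<open>j = i\<close>: translating by a point of \<open>A\<close> turns a step by
  \<open>u\<close> into a step by \<open>v\<close>, that is, it reflects the cycle.\<close>

lemma cycle_at_mult:
  assumes a: "a \<in> A"
  shows "cycle_at a i \<star> cycle_at a j = cycle_at a (2 * i - j)"
proof -
  let ?X = "cycle_at a"
  note X = cycle_at_in[OF a]
  note XQ = A_subset[OF X]
  show ?thesis
  proof (induction j rule: int_induct[where k = i])
    case base
    then show ?case using idem[OF XQ] by simp
  next
    case (step1 j)
    have "?X i \<star> ?X (j + 1) = (?X i \<star> u) \<star> (?X i \<star> ?X j)"
      using cycle_at_succ[OF a] left_distrib[OF XQ uvQ(1) XQ] by simp
    also have "\<dots> = ?X (2 * i - j - 1)"
      using step1 swaps[OF X] cycle_at_pred[OF a] by simp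
    finally show ?case by (simp add: algebra_simps)
  next
    case (step2 j)
    have "?X i \<star> ?X (j - 1) = (?X i \<star> v) \<star> (?X i \<star> ?X j)"
      using cycle_at_pred[OF a] left_distrib[OF XQ uvQ(2) XQ] by simp
    also have "\<dots> = ?X (2 * i - j + 1)"
      using step2 swaps[OF X] cycle_at_succ[OF a] by simp
    finally show ?case by (simp add: algebra_simps)
  qed
qed

lemma cycle_at_0: "cycle_at a 0 = a"
  by (simp add: cycle_at_def)

text \<open>Any set of exponents closed under \<open>2 i - j\<close> gives a subquandle of \<open>A\<close>. With \<open>M = UNIV\<close> this
  shows that the cycle is all of \<open>A\<close>, and with the multiples of a divisor of the period that
  the period is prime.\<close>

lemma cycle_at_multiples:
  assumes a: "a \<in> A" and "i \<in> M" "j \<in> M" "cycle_at a i \<noteq> cycle_at a j"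
    and M: "\<And>i j. \<lbrakk>i \<in> M; j \<in> M\<rbrakk> \<Longrightarrow> 2 * i - j \<in> M"
  shows "cycle_at a ` M = A"
proof (rule strictly_simple_full[OF simple_A left_ideal_subset[OF ideal_A] _ _ _ _ assms(4)])
  show "cycle_at a ` M \<subseteq> A" using cycle_at_in[OF a] by auto
  fix x y assume "x \<in> cycle_at a ` M" "y \<in> cycle_at a ` M"
  then show "x \<star> y \<in> cycle_at a ` M" using M by (auto simp: cycle_at_mult[OF a])
qed (use assms in auto)

lemma cycle_at_period:
  assumes a: "a \<in> A"
  obtains n :: nat where "\<And>i j. cycle_at a i = cycle_at a j \<longleftrightarrow> int n dvd i - j" "n > 0"
proof -
  let ?X = "cycle_at a"
  note X = cycle_at_in[OF a]
  have shift: "?X (i + k) = ?X (j + k)" if ij: "?X i = ?X j" for i j k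
  proof (induction k rule: int_induct[where k = 0])
    case base
    then show ?case using ij by simp
  next
    case (step1 k)
    then show ?case using cycle_at_succ[OF a, of "i + k"] cycle_at_succ[OF a, of "j + k"]
      by (simp add: add.assoc)
  next
    case (step2 k)
    then show ?case using cycle_at_pred[OF a, of "i + k"] cycle_at_pred[OF a, of "j + k"]
      by (simp add: algebra_simps)
  qed
  have "\<not> inj ?X"
  proof
    assume "inj ?X"
    moreover have "range ?X \<subseteq> Q" using X A_subset by auto
    ultimately have "finite (UNIV :: int set)"
      using finite_carrier finite_imageD finite_subset by blast
    then show False by (simp add: infinite_UNIV_int)
  qed
  then obtain i j where ij: "?X i = ?X j" "i \<noteq> j" by (auto simp: inj_def)
  have ex: "\<exists>n::nat. 0 < n \<and> ?X (int n) = ?X 0"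
  proof (rule exI[of _ "nat \<bar>i - j\<bar>"])
    show "0 < nat \<bar>i - j\<bar> \<and> ?X (int (nat \<bar>i - j\<bar>)) = ?X 0"
      using shift[OF ij(1), of "- i"] shift[OF ij(1), of "- j"] ij(2)
      by (cases "i \<ge> j") simp_all
  qed
  \<comment> \<open>Coincidences can be shifted, so all of them come from the least positive period.\<close>
  define n where "n = (LEAST n::nat. 0 < n \<and> ?X (int n) = ?X 0)"
  have n: "0 < n" "?X (int n) = ?X 0" using LeastI_ex[OF ex] by (auto simp: n_def)
  have mult: "?X (int n * k) = ?X 0" for k
  proof (induction k rule: int_induct[where k = 0])
    case (step1 k)
    then show ?case using shift[OF n(2), of "int n * k"] by (simp add: algebra_simps)
  next
    case (step2 k)
    then show ?case using shift[OF n(2), of "int n * (k - 1)"] by (simp add: algebra_simps)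
  qed simp
  have "?X i = ?X j \<longleftrightarrow> int n dvd i - j" for i j
  proof
    assume "int n dvd i - j"
    then obtain k where "i - j = int n * k" by (rule dvdE)
    then show "?X i = ?X j" using shift[OF mult, of k j] by (simp add: algebra_simps)
  next
    assume "?X i = ?X j"
    then have d: "?X (i - j) = ?X 0" using shift[of i j "- j"] by simp
    let ?r = "(i - j) mod int n"
    have "?X ?r = ?X 0"
      using shift[OF mult[of "(i - j) div int n"], of ?r] d by simp
    moreover have r: "0 \<le> ?r" "?r < int n" using n(1) by auto
    ultimately have "\<not> 0 < nat ?r"
      using not_less_Least[of "nat ?r" "\<lambda>n. 0 < n \<and> ?X (int n) = ?X 0"] by (simp add: n_def[symmetric])
    then show "int n dvd i - j" using r by (simp add: dvd_eq_mod_eq_0)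
  qed
  then show ?thesis using that n(1) by blast
qed

lemma dihedral_structure:
  "\<exists>(p::nat) (g :: 'a \<Rightarrow> int) (h :: 'a \<Rightarrow> int). prime p \<and>
      quandle_iso g A (\<star>) {0..<int p} (aff_minus_one p) \<and>
      quandle_iso h B (\<star>) {1, -1} projection \<and>
      (\<forall>a\<in>A. \<forall>e\<in>B. g (e \<star> a) = (g a + h e) mod int p \<and> h (a \<star> e) = - h e)"
proof -
  obtain a where a: "a \<in> A" using simple_A by (auto simp: strictly_simple_def nontrivial_set_def)
  let ?X = "cycle_at a"
  obtain n where n: "\<And>i j. ?X i = ?X j \<longleftrightarrow> int n dvd i - j" "n > 0"
    using cycle_at_period[OF a] by metis
  have X01: "?X 1 \<noteq> ?X 0"
    using cycle_at_succ[OF a, of 0] no_fixed_point[OF a] by (simp add: cycle_at_0)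
  have range: "range ?X = A"
    using cycle_at_multiples[OF a _ _ X01, of UNIV] by simp
  have "n \<noteq> 1" using n(1)[of 1 0] X01 by auto
  have "prime n" unfolding prime_nat_iff
  proof (intro conjI allI impI)
    show "1 < n" using \<open>n \<noteq> 1\<close> n(2) by simp
    fix m assume m: "m dvd n"
    show "m = 1 \<or> m = n"
    proof (rule ccontr)
      assume mn: "\<not> (m = 1 \<or> m = n)"
      have "\<not> n dvd m" using m mn by (auto dest: dvd_antisym)
      then have "?X (int m) \<noteq> ?X 0" using n(1)[of "int m" 0] by simp
      then have "?X ` {k. int m dvd k} = A"
        by (intro cycle_at_multiples[OF a, of "int m" _ 0]) auto
      then obtain k where k: "int m dvd k" "?X k = ?X 1" using cycle_at_in[OF a, of 1] by fastforce
      have "int m dvd k - 1" using n(1) k(2) m by (meson dvd_trans int_dvd_int_iff)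
      then have "int m dvd 1" using k(1) dvd_diff[of "int m" k "k - 1"] by simp
      then show False using mn by simp
    qed
  qed
  define g where "g = inv_into {0..<int n} ?X"
  \<comment> \<open>\<open>L\<^sub>u\<close> is the step \<open>+1\<close> along the cycle and \<open>L\<^sub>v\<close> the step \<open>-1\<close>.\<close>
  define h where "h x = (if x = u then 1 else -1 :: int)" for x
  have Xmod: "?X (k mod int n) = ?X k" for k
    by (simp add: n(1) mod_eq_dvd_iff[symmetric])
  have inj: "inj_on ?X {0..<int n}"
  proof (rule inj_onI)
    fix i j assume ij: "i \<in> {0..<int n}" "j \<in> {0..<int n}" "?X i = ?X j"
    have "i mod int n = j mod int n" using ij(3) unfolding n(1) mod_eq_dvd_iff .
    moreover have "i mod int n = i" "j mod int n = j" using ij(1,2) by simp_all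
    ultimately show "i = j" by metis
  qed
  have gX: "g (?X k) = k mod int n" for k
  proof -
    have "g (?X (k mod int n)) = k mod int n"
      unfolding g_def using inj n(2) by (intro inv_into_f_f) auto
    then show ?thesis by (simp only: Xmod)
  qed
  have "?X ` {0..<int n} = A"
  proof
    show "A \<subseteq> ?X ` {0..<int n}"
    proof
      fix x assume "x \<in> A"
      then obtain k where "x = ?X k" using range by auto
      then have "x = ?X (k mod int n)" by (simp only: Xmod)
      then show "x \<in> ?X ` {0..<int n}" using n(2) by simp
    qed
  qed (use cycle_at_in[OF a] in auto)
  then have "bij_betw g A {0..<int n}"
    unfolding g_def using inj by (intro bij_betw_inv_into) (simp add: bij_betw_def)
  moreover have "g (x \<star> y) = aff_minus_one n (g x) (g y)" if xy: "x \<in> A" "y \<in> A" for x y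
  proof -
    obtain i j where "x = ?X i" "y = ?X j" using xy range by blast
    moreover have "(2 * i - j) mod int n = (2 * (i mod int n) - j mod int n) mod int n"
      by (rule mod_diff_cong) (simp_all add: mod_mult_right_eq)
    ultimately show ?thesis by (simp add: cycle_at_mult[OF a] gX aff_minus_one_def)
  qed
  ultimately have g: "quandle_iso g A (\<star>) {0..<int n} (aff_minus_one n)"
    by (simp add: quandle_iso_def)
  have "quandle_iso h B (\<star>) {1, -1} projection"
    using uv B_proj unfolding quandle_iso_def
    by (auto simp: B_eq h_def projection_def bij_betw_def inj_on_def)
  moreover have "g (e \<star> x) = (g x + h e) mod int n \<and> h (x \<star> e) = - h e" if x: "x \<in> A" and e: "e \<in> B" for x e
  proof -
    obtain k where k: "x = ?X k" using x range by blast
    have "g (u \<star> x) = (g x + 1) mod int n" "g (v \<star> x) = (g x - 1) mod int n"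
      unfolding k cycle_at_succ[OF a, symmetric] cycle_at_pred[OF a, symmetric] gX
      by (simp_all add: mod_simps)
    then show ?thesis using e swaps[OF x] uv by (auto simp: B_eq h_def)
  qed
  ultimately show ?thesis using g \<open>prime n\<close> by blast
qed

end

end

section \<open>Permutation groups whose elements fix few points\<close>

text \<open>Let there be \<open>k\<close> orbits and let \<open>n\<close> be the group order. Stabilisers have at least two
  elements, so an orbit has at most \<open>n / 2\<close> points and \<open>E\<close> at most \<open>k n / 2\<close>. Burnside's lemma
  counts \<open>k n\<close> fixed points, of which the identity contributes the size of \<open>E\<close> and the other
  elements at most \<open>n - 1\<close>; hence \<open>k n \<le> k n / 2 + n - 1\<close>, that is, \<open>k < 2\<close>.\<close>

theorem (in group_action) transitive_if_fixes_at_most_one: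
  assumes "finite (carrier G)" "finite E"
    and stab: "\<And>x. x \<in> E \<Longrightarrow> \<exists>g\<in>carrier G. g \<noteq> \<one> \<and> \<phi> g x = x"
    and unique: "\<And>g x y. \<lbrakk>g \<in> carrier G; g \<noteq> \<one>; x \<in> E; y \<in> E; \<phi> g x = x; \<phi> g y = y\<rbrakk> \<Longrightarrow> x = y"
    and "x \<in> E" "y \<in> E"
  shows "y \<in> orbit G \<phi> x"
proof -
  interpret group G using group_hom by (rule group_hom.axioms(1))
  let ?n = "order G"
  have one: "\<one> \<in> carrier G" by simp
  have orb: "2 * card X \<le> ?n" if X: "X \<in> orbits G E \<phi>" for X
  proof -
    obtain x where x: "x \<in> E" "X = orbit G \<phi> x" using X by (auto simp: orbits_def)
    obtain g where g: "g \<in> carrier G" "g \<noteq> \<one>" "\<phi> g x = x" using stab[OF x(1)] by auto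
    have "{\<one>, g} \<subseteq> stabilizer G \<phi> x"
      using stabilizer_one_closed[OF x(1)] g by (simp add: stabilizer_def)
    moreover have "finite (stabilizer G \<phi> x)"
      using stabilizer_subset assms(1) by (rule finite_subset)
    ultimately have "card {\<one>, g} \<le> card (stabilizer G \<phi> x)" by (intro card_mono)
    then have "2 \<le> card (stabilizer G \<phi> x)" using g(2) by simp
    then have "card X * 2 \<le> card X * card (stabilizer G \<phi> x)" by (rule mult_le_mono2)
    then show ?thesis using orbit_stabilizer_theorem[OF x(1)] x(2) by simp
  qed
  have "2 * card E = (\<Sum>X\<in>orbits G E \<phi>. 2 * card X)"
    using disjoint_sum[OF assms(2), of "\<lambda>_. 2::nat"] by (simp add: mult.commute)
  also have "\<dots> \<le> card (orbits G E \<phi>) * ?n"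
    using sum_bounded_above[of "orbits G E \<phi>" "\<lambda>X. 2 * card X" ?n] orb by simp
  finally have cardE: "2 * card E \<le> card (orbits G E \<phi>) * ?n" .
  have inv1: "card (invariants E \<phi> g) \<le> 1" if "g \<in> carrier G - {\<one>}" for g
  proof (rule ccontr)
    assume "\<not> ?thesis"
    then have "2 \<le> card (invariants E \<phi> g)" by simp
    then obtain T where "T \<subseteq> invariants E \<phi> g" "card T = 2" by (rule obtain_subset_with_card_n)
    then obtain a b where "a \<noteq> b" "{a, b} \<subseteq> invariants E \<phi> g" by (auto simp: card_2_iff)
    then show False using unique[of g a b] that by (auto simp: invariants_def)
  qed
  have "(\<Sum>g\<in>carrier G - {\<one>}. card (invariants E \<phi> g)) \<le> card (carrier G - {\<one>})"
    using sum_bounded_above[of "carrier G - {\<one>}" "\<lambda>g. card (invariants E \<phi> g)" 1] inv1 by simp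
  moreover have "card (carrier G - {\<one>}) = ?n - 1"
    using assms(1) one by (simp add: order_def)
  moreover have "card (invariants E \<phi> \<one>) \<le> card E"
    using assms(2) by (intro card_mono) (auto simp: invariants_def)
  moreover have "card (orbits G E \<phi>) * ?n
      = card (invariants E \<phi> \<one>) + (\<Sum>g\<in>carrier G - {\<one>}. card (invariants E \<phi> g))"
    using burnside[OF assms(1,2)] sum.remove[OF assms(1) one, of "\<lambda>g. card (invariants E \<phi> g)"] by simp
  ultimately have "card (orbits G E \<phi>) * ?n \<le> card E + (?n - 1)" by linarith
  moreover have npos: "0 < ?n" using assms(1) one by (auto simp: order_def card_gt_0_iff)
  ultimately have "card (orbits G E \<phi>) * ?n < 2 * ?n" using cardE by linarith
  then have k: "card (orbits G E \<phi>) \<le> 1" by simp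
  have "finite (orbits G E \<phi>)" using assms(2) by (simp add: orbits_def)
  moreover have "orbit G \<phi> x \<in> orbits G E \<phi>" "orbit G \<phi> y \<in> orbits G E \<phi>"
    using assms(5,6) by (auto simp: orbits_def)
  ultimately have "orbit G \<phi> x = orbit G \<phi> y" using k by (metis card_le_Suc0_iff_eq One_nat_def)
  then show ?thesis using orbit_refl[OF assms(6)] by simp
qed

section \<open>Automorphisms\<close>

context quandle
begin

definition automorphisms :: "('a \<Rightarrow> 'a) set" where
  "automorphisms = {g \<in> Bij Q. \<forall>x\<in>Q. \<forall>y\<in>Q. g (x \<star> y) = g x \<star> g y}"

lemma automorphisms_subgroup: "subgroup automorphisms (BijGroup Q)"
proof -
  interpret B: group "BijGroup Q" by (rule group_BijGroup)
  show ?thesis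
  proof (rule B.subgroupI)
    show "automorphisms \<subseteq> carrier (BijGroup Q)" by (auto simp: automorphisms_def BijGroup_def)
    have "restrict (\<lambda>x. x) Q \<in> automorphisms" using closed by (simp add: automorphisms_def id_Bij)
    then show "automorphisms \<noteq> {}" by auto
  next
    fix g assume g: "g \<in> automorphisms"
    then have B: "g \<in> Bij Q" by (simp add: automorphisms_def)
    have "inv_into Q g (x \<star> y) = inv_into Q g x \<star> inv_into Q g y" if "x \<in> Q" "y \<in> Q" for x y
      using g that closed by (intro Bij_inv_into_lemma[OF _ B]) (auto simp: automorphisms_def)
    then show "inv\<^bsub>BijGroup Q\<^esub> g \<in> automorphisms"
      using closed restrict_inv_into_Bij[OF B] by (simp add: inv_BijGroup B automorphisms_def)
  next
    fix g h assume g: "g \<in> automorphisms" and h: "h \<in> automorphisms"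
    then have "g \<in> Bij Q" "h \<in> Bij Q" by (simp_all add: automorphisms_def)
    moreover have "h x \<in> Q" if "x \<in> Q" for x
      using Bij_imp_funcset[OF \<open>h \<in> Bij Q\<close>] that by auto
    ultimately show "g \<otimes>\<^bsub>BijGroup Q\<^esub> h \<in> automorphisms"
      using g h closed by (simp add: BijGroup_def automorphisms_def compose_Bij) (simp add: compose_def)
  qed
qed

lemma left_trans_automorphism:
  assumes "a \<in> Q" shows "left_trans Q (\<star>) a \<in> automorphisms"
  using left_trans_Bij[OF assms] left_distrib[OF assms] closed assms
  by (simp add: automorphisms_def) (simp add: left_trans_def)

end

section \<open>Two connected orbits\<close>

context finite_quandle
begin

text \<open>The elements that act on \<open>T\<close> like \<open>a\<close> form a subquandle, because \<open>L\<^bsub>x \<star> y\<^esub>\<close> is a conjugate of \<open>L\<^sub>y\<close>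
  by \<open>L\<^sub>x\<close>.\<close>

lemma same_action_mult:
  assumes T: "left_ideal Q (\<star>) T" and Q: "x \<in> Q" "y \<in> Q" "a \<in> Q"
    and x: "\<forall>e\<in>T. x \<star> e = a \<star> e" and y: "\<forall>e\<in>T. y \<star> e = a \<star> e" and e: "e \<in> T"
  shows "(x \<star> y) \<star> e = a \<star> e"
proof -
  obtain d where d: "d \<in> T" "x \<star> d = e" by (rule left_ideal_solve[OF T Q(1) e])
  have "d \<in> Q" using left_ideal_subset[OF T] d(1) by (rule subsetD)
  then have "(x \<star> y) \<star> (x \<star> d) = x \<star> (y \<star> d)"
    using left_distrib[OF Q(1,2)] by simp
  also have "\<dots> = x \<star> (a \<star> d)" using y d(1) by simp
  also have "\<dots> = a \<star> (a \<star> d)" using x left_idealD[OF T Q(3) d(1)] by simp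
  also have "\<dots> = a \<star> e" using bspec[OF x d(1)] d(2) by simp
  finally show ?thesis using d(2) by simp
qed

lemma left_div_eq:
  assumes "a \<in> Q" "c \<in> Q"
  shows "left_div Q (\<star>) a c \<in> Q" "a \<star> left_div Q (\<star>) a c = c"
  using bij_betw_imp_surj_on[OF left_bij[OF assms(1)]] assms(2)
  by (simp_all add: left_div_def inv_into_into f_inv_into_f)

lemma left_div_ideal:
  assumes "left_ideal Q (\<star>) I" "a \<in> Q" "c \<in> I"
  shows "left_div Q (\<star>) a c \<in> I"
proof -
  obtain x where x: "x \<in> I" "a \<star> x = c" by (rule left_ideal_solve[OF assms])
  have sub: "I \<subseteq> Q" using assms(1) by (rule left_ideal_subset)
  then have "left_div Q (\<star>) a c = x"
    using left_div_eq[OF assms(2), of c] cancel[OF assms(2), of _ x] x assms(3) by (metis subsetD)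
  then show ?thesis using x by simp
qed

end

context faithful_two_orbits
begin

lemma collapse_congruence:
  assumes uniform: "\<And>a b c. \<lbrakk>a \<in> A; b \<in> A; c \<in> B\<rbrakk> \<Longrightarrow> a \<star> c = b \<star> c"
  shows "quandle_congruence Q (\<star>) (A \<times> A \<union> Id_on Q)"
  unfolding quandle_congruence_def
proof
  let ?r = "A \<times> A \<union> Id_on Q"
  have AQ: "A \<subseteq> Q" using cover by auto
  show "equiv Q ?r"
    by (rule equivI) (use AQ in \<open>auto simp: refl_on_def sym_def trans_def\<close>)
  have "(a \<star> c, b \<star> d) \<in> ?r \<and> (left_div Q (\<star>) a c, left_div Q (\<star>) b d) \<in> ?r"
    if ab: "(a, b) \<in> ?r" and cd: "(c, d) \<in> ?r" for a b c d
  proof -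
    have Q: "a \<in> Q" "b \<in> Q" "c \<in> Q" "d \<in> Q" using ab cd AQ by auto
    consider "c \<in> A" "d \<in> A" | "c = d" "a = b" | "c = d" "c \<in> B" "a \<in> A" "b \<in> A"
      using ab cd cover by auto
    then show ?thesis
    proof cases
      case 1
      then show ?thesis using Q A_closed left_div_ideal[OF ideal_A] by (simp add: Id_on_iff)
    next
      case 2
      then show ?thesis using Q closed left_div_eq by (simp add: Id_on_iff)
    next
      case 3
      have "left_div Q (\<star>) a c \<in> B" using left_div_ideal[OF ideal_B Q(1) 3(2)] .
      then have "b \<star> left_div Q (\<star>) a c = b \<star> left_div Q (\<star>) b c"
        using uniform[OF 3(3,4), of "left_div Q (\<star>) a c"] left_div_eq(2)[OF Q(1,3)] left_div_eq(2)[OF Q(2,3)]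
        by simp
      then have "left_div Q (\<star>) a c = left_div Q (\<star>) b c"
        using cancel[OF Q(2) left_div_eq(1)[OF Q(1,3)] left_div_eq(1)[OF Q(2,3)]] by simp
      moreover have "a \<star> c = b \<star> c" using uniform[OF 3(3,4,2)] .
      ultimately show ?thesis using 3 Q closed left_div_eq by (simp add: Id_on_iff)
    qed
  qed
  then show "\<forall>(a, b)\<in>?r. \<forall>(c, d)\<in>?r.
      (a \<star> c, b \<star> d) \<in> ?r \<and> (left_div Q (\<star>) a c, left_div Q (\<star>) b d) \<in> ?r"
    by blast
qed

end

locale simple_two_orbits = faithful_two_orbits +
  assumes simple_A: "strictly_simple A (\<star>)" and simple_B: "strictly_simple B (\<star>)"
    and moves_A: "a \<in> A \<Longrightarrow> \<exists>b\<in>A. a \<star> b \<noteq> b" and moves_B: "a \<in> B \<Longrightarrow> \<exists>b\<in>B. a \<star> b \<noteq> b"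
    and irreducible: "subdirectly_irreducible Q (\<star>)"
begin

lemma swap_simple: "simple_two_orbits Q (\<star>) B A"
  using swap simple_A simple_B moves_A moves_B irreducible
  by (simp add: simple_two_orbits_def simple_two_orbits_axioms_def)

lemma full_A:
  assumes "T \<subseteq> A" "\<And>a b. \<lbrakk>a \<in> T; b \<in> T\<rbrakk> \<Longrightarrow> a \<star> b \<in> T" "x \<in> T" "y \<in> T" "x \<noteq> y"
  shows "T = A"
  by (rule strictly_simple_full[OF simple_A left_ideal_subset[OF ideal_A] assms])

text \<open>Let \<open>\<sigma>\<close> be the common action of \<open>A\<close> on \<open>B\<close>. Conjugation by \<open>L\<^sub>c\<close> permutes the translations by
  elements of \<open>A\<close>, so \<open>\<sigma>\<close> commutes with \<open>L\<^sub>c\<close> on \<open>B\<close>; therefore \<open>\<sigma> c\<close> acts on \<open>B\<close> like \<open>c\<close>. If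
  \<open>\<sigma> c \<noteq> c\<close>, strict simplicity makes all of \<open>B\<close> act alike on \<open>B\<close>, hence trivially by
  idempotence.\<close>

lemma uniform_imp_trivial:
  assumes uniform: "\<And>a b c. \<lbrakk>a \<in> A; b \<in> A; c \<in> B\<rbrakk> \<Longrightarrow> a \<star> c = b \<star> c"
    and a: "a \<in> A" and c: "c \<in> B"
  shows "a \<star> c = c"
proof (rule ccontr)
  assume ne: "a \<star> c \<noteq> c"
  interpret S: simple_two_orbits Q "(\<star>)" B A by (rule swap_simple)
  note Q = A_subset[OF a] B_subset[OF c]
  let ?T = "{d \<in> B. \<forall>e\<in>B. d \<star> e = c \<star> e}"
  have "(a \<star> c) \<star> e = c \<star> e" if e: "e \<in> B" for e
  proof -
    obtain d where d: "d \<in> B" "a \<star> d = e" by (rule left_ideal_solve[OF ideal_B Q(1) e])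
    have "(a \<star> c) \<star> (a \<star> d) = a \<star> (c \<star> d)"
      using left_distrib[OF Q B_subset[OF d(1)]] by simp
    also have "\<dots> = (c \<star> a) \<star> (c \<star> d)"
      using uniform[OF a A_closed[OF Q(2) a] B_closed[OF Q(2) d(1)]] .
    also have "\<dots> = c \<star> (a \<star> d)"
      using left_distrib[OF Q(2,1) B_subset[OF d(1)]] by simp
    finally show ?thesis using d by simp
  qed
  then have "?T = B"
  proof (intro S.full_A[OF _ _ _ _ ne])
    fix x y assume x: "x \<in> ?T" and y: "y \<in> ?T"
    have "\<forall>e\<in>B. (x \<star> y) \<star> e = c \<star> e"
      using same_action_mult[OF ideal_B, of x y c] B_subset c x y by simp
    moreover have "x \<star> y \<in> B" using x y B_closed[of x y] B_subset[of x] by blast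
    ultimately show "x \<star> y \<in> ?T" by blast
  qed (use c B_closed Q in auto)
  then have same: "d \<star> e = c \<star> e" if "d \<in> B" "e \<in> B" for d e using that by blast
  obtain b where b: "b \<in> B" "c \<star> b \<noteq> b" using moves_B[OF c] by blast
  have "c \<star> b = b \<star> b" using same[OF b(1) b(1)] by simp
  then show False using b idem[OF B_subset[OF b(1)]] by simp
qed

text \<open>The only place where subdirect irreducibility enters. If \<open>a \<noteq> b\<close> act alike on \<open>B\<close>, then all
  of \<open>A\<close> does, so \<open>A\<close> acts trivially on \<open>B\<close>, and \<open>B\<close> on \<open>A\<close> by \<open>fix_sym\<close>. Then collapsing
  \<open>A\<close> to a point and collapsing \<open>B\<close> to a point are congruences that meet in equality.\<close>

lemma acts_faithfully:
  assumes a: "a \<in> A" and b: "b \<in> A" and agree: "\<And>c. c \<in> B \<Longrightarrow> a \<star> c = b \<star> c"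
  shows "a = b"
proof (rule ccontr)
  assume ne: "a \<noteq> b"
  interpret S: simple_two_orbits Q "(\<star>)" B A by (rule swap_simple)
  let ?T = "{d \<in> A. \<forall>e\<in>B. d \<star> e = a \<star> e}"
  have "?T = A"
  proof (rule full_A[OF _ _ _ _ ne])
    fix x y assume x: "x \<in> ?T" and y: "y \<in> ?T"
    have "\<forall>e\<in>B. (x \<star> y) \<star> e = a \<star> e"
      using same_action_mult[OF ideal_B, of x y a] A_subset a x y by simp
    moreover have "x \<star> y \<in> A" using x y A_closed[of x y] A_subset[of x] by blast
    ultimately show "x \<star> y \<in> ?T" by blast
  qed (use a b agree in auto)
  then have same: "d \<star> e = a \<star> e" if "d \<in> A" "e \<in> B" for d e using that by blast
  have uniform: "d \<star> e = d' \<star> e" if "d \<in> A" "d' \<in> A" "e \<in> B" for d d' e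
    using same[OF that(1,3)] same[OF that(2,3)] by simp
  have "d \<star> e = e" if "d \<in> A" "e \<in> B" for d e
    using uniform_imp_trivial[OF uniform that] .
  then have "e \<star> d = d" if "d \<in> A" "e \<in> B" for d e
    using fix_sym[OF A_subset B_subset] that by blast
  then have uniform': "e \<star> d = e' \<star> d" if "e \<in> B" "e' \<in> B" "d \<in> A" for e e' d
    using that by simp
  let ?r = "A \<times> A \<union> Id_on Q" and ?s = "B \<times> B \<union> Id_on Q"
  have congs: "quandle_congruence Q (\<star>) ?r" "quandle_congruence Q (\<star>) ?s"
    using collapse_congruence[OF uniform] S.collapse_congruence[OF uniform'] by simp_all
  obtain c d where cd: "c \<in> B" "d \<in> B" "c \<noteq> d"
    using simple_B by (auto simp: strictly_simple_def nontrivial_set_def)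
  have "?r \<noteq> Id_on Q" "?s \<noteq> Id_on Q" using a b ne cd by auto
  then have "\<Inter> {r. quandle_congruence Q (\<star>) r \<and> r \<noteq> Id_on Q} \<subseteq> ?r \<inter> ?s"
    using congs by blast
  also have "\<dots> = Id_on Q" using disjoint by auto
  finally have sub: "\<Inter> {r. quandle_congruence Q (\<star>) r \<and> r \<noteq> Id_on Q} \<subseteq> Id_on Q" .
  have "Id_on Q \<subseteq> r" if "quandle_congruence Q (\<star>) r" for r
    using that by (auto simp: quandle_congruence_def equiv_def refl_on_def)
  then have "Id_on Q \<subseteq> (Q \<times> Q) \<inter> \<Inter> {r. quandle_congruence Q (\<star>) r \<and> r \<noteq> Id_on Q}"
    by blast
  then show False using sub irreducible by (auto simp: subdirectly_irreducible_def)
qed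

lemma fixed_point_unique:
  assumes "c \<in> B" "x \<in> A" "y \<in> A" "c \<star> x = x" "c \<star> y = y"
  shows "x = y"
proof (rule ccontr)
  assume ne: "x \<noteq> y"
  interpret S: simple_two_orbits Q "(\<star>)" B A by (rule swap_simple)
  have cQ: "c \<in> Q" using assms(1) by (rule B_subset)
  have "{z \<in> A. c \<star> z = z} = A"
    by (rule full_A[OF _ _ _ _ ne]) (use assms left_distrib[OF cQ] A_subset A_closed in auto)
  then have tr: "c \<star> z = z" if "z \<in> A" for z using that by blast
  have "d = c" if d: "d \<in> B" for d
  proof (rule S.acts_faithfully[OF d assms(1)])
    fix z assume z: "z \<in> A"
    show "d \<star> z = c \<star> z"
      using S.trivial_action_spreads[OF ideal_A assms(1) tr d z] tr[OF z] by simp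
  qed
  then show False using simple_B by (auto simp: strictly_simple_def nontrivial_set_def)
qed

text \<open>Each \<open>a \<in> A\<close> inherits a fixed point in \<open>B\<close>. That point in turn fixes \<open>a\<close> and nothing else in
  \<open>A\<close>, so it determines \<open>a\<close>.\<close>

lemma card_le_if_fixed_point:
  assumes "a0 \<in> A" "c0 \<in> B" "a0 \<star> c0 = c0"
  shows "card A \<le> card B"
proof -
  have "\<exists>c\<in>B. a \<star> c = c" if a: "a \<in> A" for a
  proof (rule homogeneous[where P = "\<lambda>a. \<exists>c\<in>B. a \<star> c = c", OF assms(1) _ _ a])
    show "\<exists>c\<in>B. a0 \<star> c = c" using assms by blast
    fix q a assume q: "q \<in> Q" "a \<in> A" "\<exists>c\<in>B. a \<star> c = c"
    then obtain c where c: "c \<in> B" "a \<star> c = c" by blast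
    have "(q \<star> a) \<star> (q \<star> c) = q \<star> c"
      using left_distrib[OF q(1) A_subset[OF q(2)] B_subset[OF c(1)]] c by simp
    then show "\<exists>c\<in>B. (q \<star> a) \<star> c = c" using B_closed[OF q(1) c(1)] by blast
  qed
  then obtain f where f: "\<And>a. a \<in> A \<Longrightarrow> f a \<in> B \<and> a \<star> f a = f a" by metis
  have "inj_on f A"
  proof (rule inj_onI)
    fix a b assume ab: "a \<in> A" "b \<in> A" "f a = f b"
    have "f a \<star> a = a" "f b \<star> b = b"
      using f[OF ab(1)] f[OF ab(2)] fix_sym[of _ "f _"] A_subset B_subset ab(1,2) by simp_all
    then show "a = b" using fixed_point_unique[of "f a" a b] f ab by simp
  qed
  moreover have "finite B" using finite_subset[OF left_ideal_subset[OF ideal_B] finite_carrier] .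
  ultimately show ?thesis using f by (intro card_inj_on_le[of f]) auto
qed

text \<open>The automorphism \<open>g\<close> is the identity on \<open>A\<close> because its fixed points form a subquandle. For
  \<open>c \<in> B\<close> the element \<open>g c\<close> then acts on \<open>A\<close> exactly like \<open>c\<close>, so the two are equal.\<close>

lemma automorphism_fixing_two_in_A:
  assumes g: "g \<in> automorphisms" and xy: "x \<in> A" "y \<in> A" "x \<noteq> y" "g x = x" "g y = y"
    and z: "z \<in> Q"
  shows "g z = z"
proof -
  interpret S: simple_two_orbits Q "(\<star>)" B A by (rule swap_simple)
  have hom: "g (s \<star> t) = g s \<star> g t" if "s \<in> Q" "t \<in> Q" for s t
    using g that by (simp add: automorphisms_def)
  have bij: "bij_betw g Q Q" using g by (simp add: automorphisms_def Bij_def)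
  have "{z \<in> A. g z = z} = A"
    by (rule full_A[OF _ _ _ _ xy(3)]) (use xy hom A_subset A_closed in auto)
  then have A: "g a = a" if "a \<in> A" for a using that by blast
  have B: "g c = c" if c: "c \<in> B" for c
  proof (rule S.acts_faithfully[OF _ c])
    have cQ: "c \<in> Q" using c by (rule B_subset)
    have gc: "g c \<in> Q" using bij_betw_apply[OF bij cQ] .
    have "g c \<notin> A"
    proof
      assume "g c \<in> A"
      then have "g (g c) = g c" by (rule A)
      then have "g c = c" using inj_onD[OF bij_betw_imp_inj_on[OF bij]] gc cQ by blast
      then show False using \<open>g c \<in> A\<close> c disjoint by auto
    qed
    then show "g c \<in> B" using gc cover by auto
    fix a assume a: "a \<in> A"
    show "g c \<star> a = c \<star> a"
      using hom[OF cQ A_subset[OF a]] A[OF a] A[OF A_closed[OF cQ a]] by simp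
  qed
  show ?thesis using A B z cover by auto
qed

text \<open>Fixed points \<open>a \<in> A\<close> and \<open>c \<in> B\<close> yield the second fixed point \<open>a \<star> c \<noteq> c\<close> in \<open>B\<close>.\<close>

lemma automorphism_fixing_two:
  assumes nofix: "\<And>a c. \<lbrakk>a \<in> A; c \<in> B\<rbrakk> \<Longrightarrow> a \<star> c \<noteq> c"
    and g: "g \<in> automorphisms" and xy: "x \<in> Q" "y \<in> Q" "x \<noteq> y" "g x = x" "g y = y"
    and z: "z \<in> Q"
  shows "g z = z"
proof -
  interpret S: simple_two_orbits Q "(\<star>)" B A by (rule swap_simple)
  have cross: "g z = z" if ac: "a \<in> A" "c \<in> B" "g a = a" "g c = c" for a c
  proof (rule S.automorphism_fixing_two_in_A[OF g _ ac(2) nofix[OF ac(1,2)] _ ac(4) z])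
    show "a \<star> c \<in> B" using B_closed A_subset ac by simp
    show "g (a \<star> c) = a \<star> c" using g A_subset B_subset ac by (simp add: automorphisms_def)
  qed
  consider "x \<in> A" "y \<in> A" | "x \<in> A" "y \<in> B" | "x \<in> B" "y \<in> A" | "x \<in> B" "y \<in> B"
    using xy cover by auto
  then show ?thesis
  proof cases
    case 1
    then show ?thesis using automorphism_fixing_two_in_A[OF g 1 xy(3-5) z] by simp
  next
    case 4
    then show ?thesis using S.automorphism_fixing_two_in_A[OF g 4 xy(3-5) z] by simp
  qed (use cross xy in auto)
qed

text \<open>The whole automorphism group is taken, and not only the automorphisms preserving the orbits:
  the counting argument then produces an automorphism that carries \<open>A\<close> onto \<open>B\<close>.\<close>

lemma card_le_if_no_fixed_point:
  assumes nofix: "\<And>a c. \<lbrakk>a \<in> A; c \<in> B\<rbrakk> \<Longrightarrow> a \<star> c \<noteq> c"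
  shows "card B \<le> card A"
proof -
  let ?G = "BijGroup Q \<lparr>carrier := automorphisms\<rparr>"
  interpret G: group_action ?G Q "\<lambda>g. g"
    by (rule subgroup_BijGroup_action[OF automorphisms_subgroup])
  have one: "\<one>\<^bsub>?G\<^esub> = (\<lambda>x\<in>Q. x)" by (simp add: BijGroup_def)
  obtain a c where ac: "a \<in> A" "c \<in> B"
    using simple_A simple_B by (auto simp: strictly_simple_def nontrivial_set_def)
  have "c \<in> orbit ?G (\<lambda>g. g) a"
  proof (rule G.transitive_if_fixes_at_most_one)
    have "automorphisms \<subseteq> Q \<rightarrow>\<^sub>E Q"
      by (auto simp: automorphisms_def PiE_def Bij_imp_extensional dest: Bij_imp_funcset)
    then show "finite (carrier ?G)"
      using finite_subset finite_PiE[OF finite_carrier finite_carrier] by auto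
    show "\<exists>g\<in>carrier ?G. g \<noteq> \<one>\<^bsub>?G\<^esub> \<and> g x = x" if x: "x \<in> Q" for x
    proof (intro bexI conjI)
      obtain b where "b \<in> Q" "x \<star> b \<noteq> b"
        using x moves_A moves_B cover by blast
      then have "left_trans Q (\<star>) x b \<noteq> (\<lambda>x\<in>Q. x) b" by (simp add: left_trans_def)
      then show "left_trans Q (\<star>) x \<noteq> \<one>\<^bsub>?G\<^esub>" unfolding one by metis
      show "left_trans Q (\<star>) x x = x" using x idem by (simp add: left_trans_def)
      show "left_trans Q (\<star>) x \<in> carrier ?G" using left_trans_automorphism[OF x] by simp
    qed
    show "x = y" if g: "g \<in> carrier ?G" "g \<noteq> \<one>\<^bsub>?G\<^esub>" and xy: "x \<in> Q" "y \<in> Q" "g x = x" "g y = y" for g x y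
    proof (rule ccontr)
      assume "x \<noteq> y"
      have aut: "g \<in> automorphisms" using g(1) by simp
      have "g = (\<lambda>x\<in>Q. x)"
      proof (rule extensionalityI[of _ Q])
        show "g \<in> extensional Q" using aut by (simp add: automorphisms_def Bij_imp_extensional)
        show "g z = (\<lambda>x\<in>Q. x) z" if "z \<in> Q" for z
          using automorphism_fixing_two[OF nofix aut xy(1,2) \<open>x \<noteq> y\<close> xy(3,4) that] that by simp
      qed simp
      then show False using g(2) one by simp
    qed
  qed (use ac A_subset B_subset finite_carrier in auto)
  then obtain g where g: "g \<in> automorphisms" "g a = c" by (auto simp: mem_orbit_iff)
  have hom: "g (s \<star> t) = g s \<star> g t" if "s \<in> Q" "t \<in> Q" for s t
    using g that by (simp add: automorphisms_def)
  have bij: "bij_betw g Q Q" using g by (simp add: automorphisms_def Bij_def)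
  have "left_ideal Q (\<star>) (g ` A)"
  proof (rule left_idealI)
    show "g ` A \<subseteq> Q" using bij_betw_apply[OF bij] A_subset by blast
    fix q y assume "q \<in> Q" "y \<in> g ` A"
    then obtain p x where px: "p \<in> Q" "q = g p" "x \<in> A" "y = g x"
      using bij_betw_imp_surj_on[OF bij] by (metis imageE)
    then have "q \<star> y = g (p \<star> x)" using hom A_subset by simp
    then show "q \<star> y \<in> g ` A" using A_closed px by simp
  qed
  then have "B \<subseteq> g ` A" using minimal_B[of "g ` A" c] ac g(2) by blast
  moreover have "finite A" using finite_subset[OF left_ideal_subset[OF ideal_A] finite_carrier] .
  ultimately show ?thesis by (meson card_image_le card_mono finite_imageI le_trans)
qed

theorem card_eq: "card A = card B"
proof -
  interpret S: simple_two_orbits Q "(\<star>)" B A by (rule swap_simple)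
  show ?thesis
  proof (cases "\<exists>a\<in>A. \<exists>c\<in>B. a \<star> c = c")
    case True
    then obtain a c where ac: "a \<in> A" "c \<in> B" "a \<star> c = c" by blast
    then have "c \<star> a = a" using fix_sym A_subset B_subset by simp
    then show ?thesis
      using card_le_if_fixed_point[OF ac] S.card_le_if_fixed_point[OF ac(2,1)] by simp
  next
    case False
    then have nofix: "\<And>a c. \<lbrakk>a \<in> A; c \<in> B\<rbrakk> \<Longrightarrow> a \<star> c \<noteq> c" by blast
    then have "\<And>a c. \<lbrakk>a \<in> A; c \<in> B\<rbrakk> \<Longrightarrow> c \<star> a \<noteq> a" using fix_sym A_subset B_subset by metis
    then show ?thesis
      using card_le_if_no_fixed_point[OF nofix] S.card_le_if_no_fixed_point by force
  qed
qed

end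

section \<open>The classification\<close>

theorem proposition6p5:
  fixes Q :: "'a set" and mul :: "'a \<Rightarrow> 'a \<Rightarrow> 'a" (infixl "\<star>" 70)
  assumes "quandle Q (\<star>)"
    and "finite Q"
    and "\<not> connected_quandle Q (\<star>)"
    and "faithful_quandle Q (\<star>)"
    and "subdirectly_irreducible Q (\<star>)"
    and "locally_strictly_simple Q (\<star>)"
  shows "\<exists>Q1 Q2. Q1 \<noteq> Q2 \<and> components Q (\<star>) = {Q1, Q2} \<and> Q = Q1 \<union> Q2 \<and>
    ((connected_quandle Q1 (\<star>) \<and> strictly_simple Q1 (\<star>) \<and>
        (\<exists>x. Q2 = {x} \<and> (\<forall>a\<in>Q1. x \<star> a = a)))
     \<or> (\<exists>(p::nat) (g :: 'a \<Rightarrow> int) (h :: 'a \<Rightarrow> int). prime p \<and>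
          quandle_iso g Q1 (\<star>) {0..<int p} (aff_minus_one p) \<and>
          quandle_iso h Q2 (\<star>) {1, -1} projection \<and>
          (\<forall>a\<in>Q1. \<forall>e\<in>Q2. g (e \<star> a) = (g a + h e) mod int p \<and> h (a \<star> e) = - h e))
     \<or> (connected_quandle Q1 (\<star>) \<and> strictly_simple Q1 (\<star>) \<and>
        connected_quandle Q2 (\<star>) \<and> strictly_simple Q2 (\<star>) \<and> card Q1 = card Q2))"
proof -
  interpret finite_quandle Q "(\<star>)"
    using assms(1,2) by (simp add: finite_quandle_def finite_quandle_axioms_def)
  obtain C D where comps: "components Q (\<star>) = {C, D}" "C \<noteq> D" "C \<union> D = Q" "C \<inter> D = {}"
    and C: "strictly_simple C (\<star>)" and D: "strictly_simple D (\<star>) \<or> (\<exists>x. D = {x})"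
    by (rule lss_two_components[OF assms(3,4,6)])
  have CD: "C \<in> components Q (\<star>)" "D \<in> components Q (\<star>)" using comps(1) by simp_all
  have "x = y" if "x \<in> Q" "y \<in> Q" "\<And>z. z \<in> Q \<Longrightarrow> x \<star> z = y \<star> z" for x y
    using assms(4) that restrict_ext[of Q "(\<star>) x" "(\<star>) y"]
    by (simp add: faithful_quandle_def inj_on_def left_trans_def)
  then interpret faithful_two_orbits Q "(\<star>)" C D
    using CD comps(3,4) component_subset_left_ideal component_iff_minimal_left_ideal
    by unfold_locales blast+
  have pair: "pair_orbit Q (\<star>) A B u v"
    if "faithful_two_orbits Q (\<star>) A B" "u \<noteq> v" "B = {u, v}" "\<And>a b. \<lbrakk>a \<in> B; b \<in> B\<rbrakk> \<Longrightarrow> a \<star> b = b"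
    for A B u v
    using that unfolding pair_orbit_def pair_orbit_axioms_def by blast
  have CQ: "C \<subseteq> Q" and DQ: "D \<subseteq> Q" using comps(3) by auto
  have straight: "C \<noteq> D" "components Q (\<star>) = {C, D}" "Q = C \<union> D"
    and swapped: "D \<noteq> C" "components Q (\<star>) = {D, C}" "Q = D \<union> C"
    using comps by auto
  show ?thesis
  proof (cases "connected_quandle C (\<star>)")
    case False
    obtain u v where uv: "u \<noteq> v" "C = {u, v}" "\<And>a b. \<lbrakk>a \<in> C; b \<in> C\<rbrakk> \<Longrightarrow> a \<star> b = b"
      using strictly_simple_disconnected[OF C CQ False] by metis
    interpret P: pair_orbit Q "(\<star>)" D C u v by (rule pair[OF swap uv])
    have "\<nexists>x. D = {x}"
    proof
      assume "\<exists>x. D = {x}"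
      then obtain x where x: "D = {x}" by blast
      then obtain b where "b \<in> D" "x \<star> b \<noteq> b" using P.A_not_trivial[of x] by blast
      then show False using x idem[of x] DQ by simp
    qed
    then have "strictly_simple D (\<star>)" using D by blast
    from P.dihedral_structure[OF this] show ?thesis using swapped
      by (intro exI[of _ D] exI[of _ C] conjI) (assumption | rule disjI2[OF disjI1])+
  next
    case conC: True
    show ?thesis
    proof (cases "\<exists>x. D = {x}")
      case True
      then show ?thesis using conC C singleton_acts_trivially straight
        by (intro exI[of _ C] exI[of _ D] conjI disjI1) auto
    next
      case False
      then have sD: "strictly_simple D (\<star>)" using D by blast
      show ?thesis
      proof (cases "connected_quandle D (\<star>)")
        case False
        obtain u v where uv: "u \<noteq> v" "D = {u, v}" "\<And>a b. \<lbrakk>a \<in> D; b \<in> D\<rbrakk> \<Longrightarrow> a \<star> b = b"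
          using strictly_simple_disconnected[OF sD DQ False] by metis
        interpret P: pair_orbit Q "(\<star>)" C D u v
          by (rule pair[OF faithful_two_orbits_axioms uv])
        show ?thesis using P.dihedral_structure[OF C] straight
          by (intro exI[of _ C] exI[of _ D] conjI) (assumption | rule disjI2[OF disjI1])+
      next
        case True
        interpret S: faithful_two_orbits Q "(\<star>)" D C by (rule swap)
        interpret simple_two_orbits Q "(\<star>)" C D
          using connected_not_trivial[OF conC C] S.connected_not_trivial[OF True sD] C sD assms(5)
          by unfold_locales
        show ?thesis using conC C True sD card_eq straight
          by (intro exI[of _ C] exI[of _ D] conjI disjI2) assumption+
      qed
    qed
  qed
qed

end
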